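(* Let $n\ge 3$. Any Lagrangian submanifold of $\mathbb{R}^{2n}\simeq\mathbb{C}^n$ which is foliated by round $(n-1)$-spheres is locally the image of an immersion of the form $$\ell: I\times\mathbb{S}^{n-1}\to\mathbb{C}^n\simeq\mathbb{R}^{2n},\qquad (s,x)\mapsto r(s)e^{i\phi(s)}x+\int_{s_0}^{s}e^{i\phi(t)}W(t)\,dt,$$ where $I$ is an interval, $s\mapsto\gamma(s):=r(s)e^{i\phi(s)}$ is a planar curve, $W$ is a curve from $I$ into $\mathbb{R}^n$, and $s_0\in I$.
   Context: $\mathbb{C}^n\simeq\mathbb{R}^{2n}$ has coordinates $z_j=x_j+iy_j$, $1\le j\le n$, the standard Hermitian form, and the associated symplectic form $\omega=\sum_{j=1}^n dx_j\wedge dy_j$. A submanifold is Lagrangian if it has real dimension $n$ and $\omega$ vanishes on its tangent spaces. $\mathbb{R}^n=\{y_1=\dots=y_n=0\}\subset\mathbb{C}^n$, and $\mathbb{S}^{n-1}$ is the unit sphere of this $\mathbb{R}^n$. An $n$-dimensional submanifold of $\mathbb{R}^{2n}$ foliated by round $(n-1)$-spheres is locally parametrized by immersions $(s,x)\in I\times\mathbb{S}^{n-1}\mapsto r(s)M(s)x+V(s)$, with $I$ an interval and, for all $s\in I$, $r(s)\in\mathbb{R}^+$, $M(s)\in SO(2n)$, $V(s)\in\mathbb{C}^n$.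
   Formalization: The submanifold is shown to be locally the image of such an immersion only after composing with a unitary map and a translation of C^n (which may depend on the piece); without this the claim fails, e.g. for R^{n-1} x iR minus the origin foliated by concentric spheres. *)

theory Defs
  imports "HOL-Analysis.Analysis"
begin

section \<open>Smooth maps, submanifolds, tangent spaces and immersions\<close>

text \<open>Both notions are meant for open \<open>S\<close>. For a finite-dimensional domain, \<open>smooth_on S f\<close>
  says that \<open>f\<close> is of class $C^\infty$ on \<open>S\<close>.\<close>

fun Ck_on :: "nat \<Rightarrow> 'a::real_normed_vector set \<Rightarrow> ('a \<Rightarrow> 'b::real_normed_vector) \<Rightarrow> bool" where
  "Ck_on 0 S f \<longleftrightarrow> continuous_on S f"
| "Ck_on (Suc k) S f \<longleftrightarrow>
     (\<forall>x\<in>S. f differentiable (at x)) \<and>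
     (\<forall>v. Ck_on k S (\<lambda>x. frechet_derivative f (at x) v))"

definition smooth_on :: "'a::real_normed_vector set \<Rightarrow> ('a \<Rightarrow> 'b::real_normed_vector) \<Rightarrow> bool" where
  "smooth_on S f \<longleftrightarrow> (\<forall>k. Ck_on k S f)"

definition submanifold :: "nat \<Rightarrow> 'a::euclidean_space set \<Rightarrow> bool" where
  "submanifold k N \<longleftrightarrow>
     (\<forall>p\<in>N. \<exists>A B (h :: 'a \<Rightarrow> 'a) g E.
        open A \<and> p \<in> A \<and> open B \<and>
        homeomorphism A B h g \<and> smooth_on A h \<and> smooth_on B g \<and>
        subspace E \<and> dim E = k \<and> h ` (N \<inter> A) = E \<inter> B)"

definition tangent_space :: "'a::euclidean_space set \<Rightarrow> 'a \<Rightarrow> 'a set" where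
  "tangent_space N p =
     {v. \<exists>e c. 0 < e \<and> smooth_on {-e<..<e} c \<and> c ` {-e<..<e} \<subseteq> N \<and> c 0 = p \<and>
               (c has_vector_derivative v) (at (0::real))}"

text \<open>A map defined on a submanifold \<open>N\<close> is smooth if it extends smoothly to a neighbourhood of
  each point of \<open>N\<close>; its differential is the restriction to the tangent space of the derivative
  of any such extension. Values of \<open>f\<close> outside \<open>N\<close> are irrelevant.\<close>

definition immersion_on :: "'a::euclidean_space set \<Rightarrow> ('a \<Rightarrow> 'b::euclidean_space) \<Rightarrow> bool" where
  "immersion_on N f \<longleftrightarrow>
     (\<forall>p\<in>N. \<exists>A F.
        open A \<and> p \<in> A \<and> smooth_on A F \<and> (\<forall>q\<in>N \<inter> A. F q = f q) \<and>
        inj_on (frechet_derivative F (at p)) (tangent_space N p))"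

section \<open>Complex space and its symplectic form\<close>

definition real_to_complex_vec :: "real ^ 'n \<Rightarrow> complex ^ 'n" where
  "real_to_complex_vec x = (\<chi> j. complex_of_real (x $ j))"

text \<open>The identification of complex $n$-space with real $2n$-space: the coordinates \<open>Inl j\<close> are
  the $x_j$, the coordinates \<open>Inr j\<close> are the $y_j$.\<close>

definition real_coords :: "complex ^ 'n \<Rightarrow> real ^ ('n + 'n)" where
  "real_coords z = (\<chi> k. case k of Inl j \<Rightarrow> Re (z $ j) | Inr j \<Rightarrow> Im (z $ j))"

definition of_real_coords :: "real ^ ('n + 'n) \<Rightarrow> complex ^ 'n" where
  "of_real_coords u = (\<chi> j. Complex (u $ Inl j) (u $ Inr j))"

lemma of_real_coords_real_coords [simp]: "of_real_coords (real_coords z) = z"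
  by (simp add: of_real_coords_def real_coords_def vec_eq_iff)

lemma real_coords_of_real_coords [simp]: "real_coords (of_real_coords u) = u"
  by (auto simp: of_real_coords_def real_coords_def vec_eq_iff split: sum.split)

definition symplectic_form :: "complex ^ 'n \<Rightarrow> complex ^ 'n \<Rightarrow> real" where
  "symplectic_form u v = (\<Sum>j\<in>UNIV. Re (u $ j) * Im (v $ j) - Im (u $ j) * Re (v $ j))"

definition lagrangian_submanifold :: "(complex ^ 'n) set \<Rightarrow> bool" where
  "lagrangian_submanifold L \<longleftrightarrow>
     submanifold CARD('n) L \<and>
     (\<forall>p\<in>L. \<forall>u\<in>tangent_space L p. \<forall>v\<in>tangent_space L p. symplectic_form u v = 0)"

text \<open>The normal form below fixes both the plane of the spheres (a complex phase times real
  $n$-space) and one centre (the origin), so it can only describe a submanifold up to a unitary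
  map and a translation: a concentric foliation of a different Lagrangian plane is not literally
  of that form.\<close>

definition unitary_matrix :: "complex ^ 'n ^ 'n \<Rightarrow> bool" where
  "unitary_matrix U \<longleftrightarrow> (\<chi> i j. cnj (U $ j $ i)) ** U = mat 1"

section \<open>Foliations by round spheres\<close>

text \<open>For \<open>r s > 0\<close> and \<open>M s\<close> in the special orthogonal group of real $2n$-space, the image of
  \<open>{s} \<times> sphere 0 1\<close> is a round $(n-1)$-sphere with centre \<open>V s\<close> and radius \<open>r s\<close>.\<close>

definition sphere_family ::
  "(real \<Rightarrow> real) \<Rightarrow> (real \<Rightarrow> real ^ ('n + 'n) ^ ('n + 'n)) \<Rightarrow> (real \<Rightarrow> complex ^ 'n)
     \<Rightarrow> real \<times> (real ^ 'n) \<Rightarrow> complex ^ 'n" where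
  "sphere_family r M V =
     (\<lambda>(s, x). r s *\<^sub>R of_real_coords (M s *v real_coords (real_to_complex_vec x)) + V s)"

text \<open>The leaves form a partition of \<open>L\<close>, and around each of its points \<open>L\<close> is parametrized by an
  immersion whose slices are leaves. Only the immersion itself is required to be smooth: \<open>M s\<close>
  matters only through its restriction to real $n$-space.\<close>

definition foliated_by_round_spheres :: "(complex ^ 'n) set \<Rightarrow> bool" where
  "foliated_by_round_spheres L \<longleftrightarrow>
     (\<exists>\<F>. partition_on L \<F> \<and>
        (\<forall>p\<in>L. \<exists>I r M V.
           open I \<and> is_interval I \<and>
           (\<forall>s\<in>I. r s > 0 \<and> rotation_matrix (M s)) \<and>
           immersion_on (I \<times> sphere 0 1) (sphere_family r M V) \<and>
           (\<forall>s\<in>I. sphere_family r M V ` ({s} \<times> sphere 0 1) \<in> \<F>) \<and>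
           p \<in> sphere_family r M V ` (I \<times> sphere 0 1) \<and>
           openin (top_of_set L) (sphere_family r M V ` (I \<times> sphere 0 1))))"

text \<open>The interval integral is oriented, so that \<open>s < s0\<close> is allowed.\<close>

definition lagrangian_sphere_param ::
  "(real \<Rightarrow> real) \<Rightarrow> (real \<Rightarrow> real) \<Rightarrow> (real \<Rightarrow> real ^ 'n) \<Rightarrow> real
     \<Rightarrow> real \<times> (real ^ 'n) \<Rightarrow> complex ^ 'n" where
  "lagrangian_sphere_param r \<phi> W s0 =
     (\<lambda>(s, x). (complex_of_real (r s) * exp (\<i> * complex_of_real (\<phi> s))) *s real_to_complex_vec x
        + (LBINT t=ereal s0..ereal s.
             exp (\<i> * complex_of_real (\<phi> t)) *s real_to_complex_vec (W t)))"

end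

theory Submission
  imports Defs
begin

text \<open>A chart has the form \<open>F(s, x) = A(s) x + V(s)\<close> with \<open>A(s)\<close> real-linear and
  \<open>|A(s) x| = r(s) |x|\<close>. Since \<open>n \<ge> 3\<close>, any two basis vectors are tangent to the unit sphere
  at a third one, so \<open>A(s)\<close> maps real \<open>n\<close>-space to a Lagrangian plane and \<open>A = r B\<close> with
  \<open>B(s)\<close> unitary. Pairing the transversal direction \<open>A' x + V'\<close> with the tangent directions of
  the sphere shows that \<open>B\<^sup>* V'\<close> is real and that the imaginary part of \<open>B\<^sup>* B'\<close> is a multiple
  \<open>\<tau>\<close> of the identity. Hence \<open>B(s) = e\<^bsup>i\<phi>(s)\<^esup> B(s0) D(s)\<close> with \<open>\<phi>' = \<tau>\<close> and \<open>D(s)\<close> real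
  orthogonal, and \<open>D(s)\<close> is absorbed by a reparametrization of the sphere.\<close>

section \<open>Calculus of smooth maps\<close>

text \<open>The functions \<open>r\<close>, \<open>M\<close>, \<open>V\<close> of a chart need not
  be smooth; \<open>immersion_on\<close> only provides smoothness of the whole map. As
  \<open>x\<close> and \<open>- x\<close> both lie on the sphere, half the sum and half the
  difference of the curves through antipodal points recover \<open>V\<close> and the columns of
  \<open>A\<close>, and a column then yields \<open>r\<close>. For n = 2 the sphere has a single
  tangent line at each point, and the circle directions say nothing about \<open>A\<close>; a third
  index is what lets two columns be paired. The phase comes from integrating \<open>\<tau>\<close>,
  which avoids choosing an argument of a determinant and allows the normalization that it vanish at
  \<open>s0\<close>. The unitary map of the conclusion is \<open>B s0\<close> and the translation is
  \<open>V s0\<close>, the place where the integral starts. The last obstacle is the immersion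
  property of the new chart: \<open>tangent_space\<close> is a mere set of velocities, with no
  linear structure at hand, so injectivity cannot be tested on a kernel and is transported along
  curves instead.\<close>

lemma Ck_on_cong:
  assumes "open S" "\<And>x. x \<in> S \<Longrightarrow> f x = g x" "Ck_on k S f"
  shows "Ck_on k S g"
  using assms(2,3)
proof (induction k arbitrary: f g)
  case 0
  then show ?case by (simp cong: continuous_on_cong)
next
  case (Suc k)
  have d: "(g has_derivative frechet_derivative f (at x)) (at x)" if "x \<in> S" for x
    using has_derivative_transform_within_open[of f "frechet_derivative f (at x)" x UNIV S g]
      Suc.prems that frechet_derivative_works assms(1) by auto
  have e: "frechet_derivative g (at x) = frechet_derivative f (at x)" if "x \<in> S" for x
    using frechet_derivative_at[OF d[OF that]] by simp
  have "Ck_on k S (\<lambda>x. frechet_derivative g (at x) v)" for v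
    by (rule Suc.IH[of "\<lambda>x. frechet_derivative f (at x) v"]) (use Suc.prems e in auto)
  then show ?case using d by (auto simp: differentiable_def)
qed

text \<open>Trades the choice operator behind \<open>frechet_derivative\<close> for an explicit
  derivative; all closure properties below go through it.\<close>

lemma Ck_on_SucI:
  assumes "open S" "\<And>x. x \<in> S \<Longrightarrow> (f has_derivative f' x) (at x)"
    and "\<And>v. Ck_on k S (\<lambda>x. f' x v)"
  shows "Ck_on (Suc k) S f"
proof -
  have "frechet_derivative f (at x) = f' x" if "x \<in> S" for x
    using frechet_derivative_at[OF assms(2)[OF that]] by simp
  then have "Ck_on k S (\<lambda>x. frechet_derivative f (at x) v)" for v
    by (intro Ck_on_cong[OF assms(1) _ assms(3)[of v]]) auto
  then show ?thesis using assms(2) by (auto simp: differentiable_def)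
qed

lemma Ck_on_Suc_has_derivative:
  "Ck_on (Suc k) S f \<Longrightarrow> x \<in> S \<Longrightarrow> (f has_derivative frechet_derivative f (at x)) (at x)"
  using frechet_derivative_works by auto

lemma Ck_on_Suc_imp: "Ck_on (Suc k) S f \<Longrightarrow> Ck_on k S f"
proof (induction k arbitrary: f)
  case 0
  then show ?case
    by (auto intro!: continuous_at_imp_continuous_on differentiable_imp_continuous_within)
next
  case (Suc k)
  then have "Ck_on k S (\<lambda>x. frechet_derivative f (at x) v)" for v
    using iffD1[OF Ck_on.simps(2) Suc.prems] by (intro Suc.IH) (rule spec[OF conjunct2])
  with iffD1[OF Ck_on.simps(2) Suc.prems] show ?case by simp
qed

lemma smooth_on_cong:
  "open S \<Longrightarrow> (\<And>x. x \<in> S \<Longrightarrow> f x = g x) \<Longrightarrow> smooth_on S f \<Longrightarrow> smooth_on S g"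
  unfolding smooth_on_def using Ck_on_cong by metis

lemma smooth_on_has_derivative:
  "smooth_on S f \<Longrightarrow> x \<in> S \<Longrightarrow> (f has_derivative frechet_derivative f (at x)) (at x)"
  unfolding smooth_on_def using Ck_on_Suc_has_derivative by blast

text \<open>Being differentiable at a point and the value of the derivative there are local. Needed
  because \<open>immersion_on\<close> supplies a different extension near each point.\<close>

lemma smooth_on_local:
  assumes "\<And>x. x \<in> S \<Longrightarrow> \<exists>T. open T \<and> x \<in> T \<and> smooth_on T f"
  shows "smooth_on S f"
proof -
  have "Ck_on k S f" if "\<And>x. x \<in> S \<Longrightarrow> \<exists>T. open T \<and> x \<in> T \<and> Ck_on k T f" for k
    using that
  proof (induction k arbitrary: f)
    case 0
    then show ?case
      by (auto intro!: continuous_at_imp_continuous_on)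
         (metis continuous_on_eq_continuous_at)
  next
    case (Suc k)
    have "f differentiable (at x)" if "x \<in> S" for x
      using Suc.prems[OF that] by auto
    moreover have "Ck_on k S (\<lambda>x. frechet_derivative f (at x) v)" for v
    proof (rule Suc.IH)
      fix x assume "x \<in> S"
      from Suc.prems[OF this] obtain T where "open T" "x \<in> T" "Ck_on (Suc k) T f" by blast
      then show "\<exists>T. open T \<and> x \<in> T \<and> Ck_on k T (\<lambda>x. frechet_derivative f (at x) v)"
        by (intro exI[of _ T]) auto
    qed
    ultimately show ?case by simp
  qed
  then show ?thesis using assms unfolding smooth_on_def by blast
qed

lemma smooth_on_const [intro, simp]: "smooth_on S (\<lambda>x. c)"
proof -
  have "Ck_on k S (\<lambda>x. c)" for k
    by (induction k arbitrary: c) auto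
  then show ?thesis by (simp add: smooth_on_def)
qed

lemma smooth_on_bounded_linear:
  assumes "bounded_linear L"
  shows "smooth_on S L"
proof -
  have "frechet_derivative L (at x) = L" for x
    using frechet_derivative_at[OF bounded_linear_imp_has_derivative[OF assms]] by simp
  then have "Ck_on (Suc k) S L" for k
    using bounded_linear_imp_differentiable[OF assms]
    by (simp add: smooth_on_const[unfolded smooth_on_def, rule_format])
  then show ?thesis using Ck_on_Suc_imp unfolding smooth_on_def by blast
qed

lemma Ck_on_add:
  assumes "open S" "Ck_on k S f" "Ck_on k S g"
  shows "Ck_on k S (\<lambda>x. f x + g x)"
  using assms(2,3)
proof (induction k arbitrary: f g)
  case 0
  then show ?case by (auto intro: continuous_on_add)
next
  case (Suc k)
  show ?case
    by (rule Ck_on_SucI[OF assms(1)])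
       (rule has_derivative_add[OF Suc.prems(1)[THEN Ck_on_Suc_has_derivative]
          Suc.prems(2)[THEN Ck_on_Suc_has_derivative]], use Suc in auto)
qed

lemma smooth_on_add:
  "open S \<Longrightarrow> smooth_on S f \<Longrightarrow> smooth_on S g \<Longrightarrow> smooth_on S (\<lambda>x. f x + g x)"
  unfolding smooth_on_def using Ck_on_add by blast

lemma smooth_on_sum:
  "open S \<Longrightarrow> (\<And>i. i \<in> A \<Longrightarrow> smooth_on S (f i)) \<Longrightarrow> smooth_on S (\<lambda>x. \<Sum>i\<in>A. f i x)"
  by (induction A rule: infinite_finite_induct) (auto intro: smooth_on_add)

text \<open>A single Leibniz induction serves scalar multiples, products, inner products and
  matrix-vector products.\<close>

lemma (in bounded_bilinear) Ck_on_prod: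
  assumes "open S" "Ck_on k S f" "Ck_on k S g"
  shows "Ck_on k S (\<lambda>x. prod (f x) (g x))"
  using assms(2,3)
proof (induction k arbitrary: f g)
  case 0
  then show ?case by (auto intro: continuous_on)
next
  case (Suc k)
  show ?case
  proof (rule Ck_on_SucI[OF assms(1)])
    show "((\<lambda>x. prod (f x) (g x)) has_derivative
            (\<lambda>h. prod (f x) (frechet_derivative g (at x) h) +
                 prod (frechet_derivative f (at x) h) (g x))) (at x)" if "x \<in> S" for x
      by (intro FDERIV Suc.prems[THEN Ck_on_Suc_has_derivative] that)
    show "Ck_on k S (\<lambda>x. prod (f x) (frechet_derivative g (at x) v) +
                 prod (frechet_derivative f (at x) v) (g x))" for v
      by (intro Ck_on_add[OF assms(1)] Suc.IH) (use Suc.prems Ck_on_Suc_imp in auto)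
  qed
qed

lemma (in bounded_bilinear) smooth_on_prod:
  "open S \<Longrightarrow> smooth_on S f \<Longrightarrow> smooth_on S g \<Longrightarrow> smooth_on S (\<lambda>x. prod (f x) (g x))"
  unfolding smooth_on_def using Ck_on_prod by blast

lemmas smooth_on_scaleR = bounded_bilinear.smooth_on_prod[OF bounded_bilinear_scaleR]
lemmas smooth_on_mult = bounded_bilinear.smooth_on_prod[OF bounded_bilinear_mult]
lemmas smooth_on_inner = bounded_bilinear.smooth_on_prod[OF bounded_bilinear_inner]

lemma smooth_on_linear_compose:
  assumes "bounded_linear L" "open S" "smooth_on S f"
  shows "smooth_on S (\<lambda>x. L (f x))"
proof -
  interpret bounded_linear L by fact
  have "Ck_on k S (\<lambda>x. L (f x))" if "Ck_on k S f" for k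
    using that
  proof (induction k arbitrary: f)
    case 0
    then show ?case by (auto intro: continuous_on)
  next
    case (Suc k)
    show ?case
    proof (rule Ck_on_SucI[OF assms(2)])
      show "((\<lambda>x. L (f x)) has_derivative (\<lambda>h. L (frechet_derivative f (at x) h))) (at x)"
        if "x \<in> S" for x
        by (intro has_derivative Suc.prems[THEN Ck_on_Suc_has_derivative] that)
      show "Ck_on k S (\<lambda>x. L (frechet_derivative f (at x) v))" for v
        by (intro Suc.IH) (use Suc.prems in auto)
    qed
  qed
  then show ?thesis using assms(3) by (simp add: smooth_on_def)
qed

lemma smooth_on_diff:
  "open S \<Longrightarrow> smooth_on S f \<Longrightarrow> smooth_on S g \<Longrightarrow> smooth_on S (\<lambda>x. f x - g x)"
  using smooth_on_add[OF _ _ smooth_on_linear_compose[OF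
      bounded_linear_minus[OF bounded_linear_ident]], of S f g] by simp

text \<open>The chain rule differentiates \<open>f\<close> in the constant direction
  \<open>L v\<close>, so the induction stays within maps of the same shape. Used to shift curves to
  the parameter 0 and to restrict maps to slices with \<open>x\<close> fixed.\<close>

lemma smooth_on_affine_compose:
  assumes "bounded_linear L" "open T" "\<And>x. x \<in> T \<Longrightarrow> L x + c \<in> S" "smooth_on S f"
  shows "smooth_on T (\<lambda>x. f (L x + c))"
proof -
  have "Ck_on k T (\<lambda>x. f (L x + c))" if "Ck_on k S f" for k
    using that
  proof (induction k arbitrary: f)
    case 0
    have "continuous_on T (\<lambda>x. L x + c)"
      using assms(1) by (intro continuous_intros linear_continuous_on)
    with 0 show ?case
      using assms(3) by (auto intro: continuous_on_compose2)
  next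
    case (Suc k)
    show ?case
    proof (rule Ck_on_SucI[OF assms(2)])
      show "((\<lambda>x. f (L x + c)) has_derivative (\<lambda>h. frechet_derivative f (at (L x + c)) (L h))) (at x)"
        if "x \<in> T" for x
      proof -
        have "((\<lambda>x. L x + c) has_derivative L) (at x)"
          by (rule has_derivative_add_const) (rule bounded_linear_imp_has_derivative[OF assms(1)])
        from diff_chain_at[OF this Ck_on_Suc_has_derivative[OF Suc.prems assms(3)[OF that]]]
        show ?thesis by (simp add: o_def)
      qed
      show "Ck_on k T (\<lambda>x. frechet_derivative f (at (L x + c)) (L v))" for v
        by (rule Suc.IH[of "\<lambda>y. frechet_derivative f (at y) (L v)"]) (use Suc.prems in auto)
    qed
  qed
  then show ?thesis using assms(4) by (simp add: smooth_on_def)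
qed

text \<open>The parameter being real, the chain rule involves the derivative of the outer map in a
  single direction only, so that the induction needs no basis expansion.\<close>

lemma smooth_on_compose_real:
  fixes g :: "'a::real_normed_vector \<Rightarrow> real"
  assumes "open S" "smooth_on T f" "smooth_on S g" "g ` S \<subseteq> T"
  shows "smooth_on S (\<lambda>x. f (g x))"
proof -
  have "Ck_on k S (\<lambda>x. f (g x))" if "Ck_on k T f" "Ck_on k S g" for k
    using that
  proof (induction k arbitrary: f)
    case 0
    then show ?case using assms(4) by (auto intro: continuous_on_compose2)
  next
    case (Suc k)
    show ?case
    proof (rule Ck_on_SucI[OF assms(1)])
      show "((\<lambda>x. f (g x)) has_derivative (\<lambda>h. frechet_derivative g (at x) h *\<^sub>R
              frechet_derivative f (at (g x)) 1)) (at x)"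
        if "x \<in> S" for x
      proof -
        have f: "(f has_derivative frechet_derivative f (at (g x))) (at (g x))"
          using Suc.prems(1) that assms(4) by (auto intro!: Ck_on_Suc_has_derivative)
        interpret f: bounded_linear "frechet_derivative f (at (g x))"
          using f by (rule has_derivative_bounded_linear)
        have f1: "frechet_derivative f (at (g x)) h = h *\<^sub>R frechet_derivative f (at (g x)) 1" for h
          using f.scaleR[of h 1] by simp
        show ?thesis
          by (intro has_derivative_eq_rhs[OF diff_chain_at[OF
              Ck_on_Suc_has_derivative[OF Suc.prems(2) that] f, unfolded o_def]] ext f1)
      qed
      show "Ck_on k S (\<lambda>x. frechet_derivative g (at x) v *\<^sub>R
              frechet_derivative f (at (g x)) 1)" for v
        by (intro bounded_bilinear.Ck_on_prod[OF bounded_bilinear_scaleR] assms(1)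
            Suc.IH[of "\<lambda>y. frechet_derivative f (at y) 1"])
          (use Suc.prems Ck_on_Suc_imp[OF Suc.prems(2)] in auto)
    qed
  qed
  then show ?thesis using assms(2,3) by (simp add: smooth_on_def)
qed

lemma smooth_on_vec:
  fixes f :: "'a::real_normed_vector \<Rightarrow> 'b::euclidean_space ^ 'n"
  assumes "open S" "\<And>i. smooth_on S (\<lambda>x. f x $ i)"
  shows "smooth_on S f"
proof -
  have lin: "bounded_linear (\<lambda>y::'b. axis i y :: 'b ^ 'n)" for i
    unfolding linear_conv_bounded_linear[symmetric]
    by (auto simp: linear_iff vec_eq_iff axis_def)
  have "smooth_on S (\<lambda>x. \<Sum>i\<in>UNIV. axis i (f x $ i))"
    by (intro smooth_on_sum assms smooth_on_linear_compose[OF lin])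
  then show ?thesis
    by (rule smooth_on_cong[OF assms(1), rotated])
       (simp add: vec_eq_iff axis_def if_distrib cong: if_cong)
qed

lemma smooth_on_vec_nth: "open S \<Longrightarrow> smooth_on S f \<Longrightarrow> smooth_on S (\<lambda>x. f x $ i)"
  by (rule smooth_on_linear_compose[OF bounded_linear_vec_nth])

lemma smooth_on_Pair:
  fixes f :: "'a::real_normed_vector \<Rightarrow> 'b::real_normed_vector"
    and g :: "'a \<Rightarrow> 'c::real_normed_vector"
  assumes "open S" "smooth_on S f" "smooth_on S g"
  shows "smooth_on S (\<lambda>x. (f x, g x))"
proof -
  have "bounded_linear (\<lambda>y::'b. (y, 0::'c))" "bounded_linear (\<lambda>y::'c. (0::'b, y))"
    by (auto intro: bounded_linear_intros)
  from smooth_on_add[OF assms(1) smooth_on_linear_compose[OF this(1) assms(1,2)]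
      smooth_on_linear_compose[OF this(2) assms(1,3)]]
  show ?thesis by simp
qed

text \<open>For maps solving an equation such as \<open>f' = \<i> \<phi>' f\<close>, where each derivative of \<open>f'\<close> is
  controlled by one fewer derivative of \<open>f\<close>.\<close>

lemma smooth_on_bootstrap:
  assumes "open S" "\<And>x. x \<in> S \<Longrightarrow> (f has_derivative f' x) (at x)"
    and step: "\<And>k v. Ck_on k S f \<Longrightarrow> Ck_on k S (\<lambda>x. f' x v)"
  shows "smooth_on S f"
proof -
  have "Ck_on k S f" for k
  proof (induction k)
    case 0
    show ?case using assms(2)
      by (auto intro!: continuous_at_imp_continuous_on dest: has_derivative_continuous)
  next
    case (Suc k)
    show ?case by (rule Ck_on_SucI[OF assms(1,2) step[OF Suc]])
  qed
  then show ?thesis by (simp add: smooth_on_def)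
qed

lemma smooth_on_exp:
  fixes g :: "'a::real_normed_vector \<Rightarrow> complex"
  assumes "open S" "smooth_on S g"
  shows "smooth_on S (\<lambda>x. exp (g x))"
proof (rule smooth_on_bootstrap[OF assms(1)])
  show "((\<lambda>x. exp (g x)) has_derivative (\<lambda>h. exp (g x) * frechet_derivative g (at x) h)) (at x)"
    if "x \<in> S" for x
    using diff_chain_at[OF smooth_on_has_derivative[OF assms(2) that]
        DERIV_exp[unfolded has_field_derivative_def]] by (simp add: o_def)
  show "Ck_on k S (\<lambda>x. exp (g x) * frechet_derivative g (at x) v)"
    if "Ck_on k S (\<lambda>x. exp (g x))" for k v
    using assms(2)[unfolded smooth_on_def, rule_format, of "Suc k"] that
    by (intro bounded_bilinear.Ck_on_prod[OF bounded_bilinear_mult] assms(1)) auto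
qed

text \<open>The inverse root \<open>u\<close> satisfies \<open>u' = - (1/2) * u^3 * q'\<close>,
  polynomial in \<open>u\<close>, so bootstrapping applies; the root itself is recovered later as
  \<open>q * u\<close>.\<close>

lemma smooth_on_inverse_sqrt:
  fixes q :: "'a::real_normed_vector \<Rightarrow> real"
  assumes "open S" "smooth_on S q" "\<And>x. x \<in> S \<Longrightarrow> q x > 0"
  shows "smooth_on S (\<lambda>x. inverse (sqrt (q x)))"
proof (rule smooth_on_bootstrap[OF assms(1)])
  let ?u = "\<lambda>x. inverse (sqrt (q x))"
  show "(?u has_derivative
          (\<lambda>h. (?u x * (?u x * ?u x)) * (- (1/2) * frechet_derivative q (at x) h))) (at x)"
    if "x \<in> S" for x
    using assms(3)[OF that] real_sqrt_gt_zero[OF assms(3)[OF that]]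
    by (auto intro!: derivative_eq_intros smooth_on_has_derivative[OF assms(2) that]
        simp: field_simps)
  show "Ck_on k S (\<lambda>x. (?u x * (?u x * ?u x)) * (- (1/2) * frechet_derivative q (at x) v))"
    if "Ck_on k S ?u" for k v
    using assms(2)[unfolded smooth_on_def, rule_format, of "Suc k"] that
      smooth_on_const[unfolded smooth_on_def]
    by (intro bounded_bilinear.Ck_on_prod[OF bounded_bilinear_mult] assms(1)) auto
qed

lemma smooth_on_vector_derivative:
  fixes f :: "real \<Rightarrow> 'a::real_normed_vector"
  assumes "smooth_on S f"
  obtains f' where "smooth_on S f'" "\<And>x. x \<in> S \<Longrightarrow> (f has_vector_derivative f' x) (at x)"
proof
  let ?f' = "\<lambda>x. frechet_derivative f (at x) 1"
  have "Ck_on (Suc k) S f" for k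
    using assms unfolding smooth_on_def by blast
  then show "smooth_on S ?f'" by (simp add: smooth_on_def)
  show "(f has_vector_derivative ?f' x) (at x)" if "x \<in> S" for x
  proof -
    note d = smooth_on_has_derivative[OF assms that]
    interpret bounded_linear "frechet_derivative f (at x)"
      using d by (rule has_derivative_bounded_linear)
    have "frechet_derivative f (at x) h = h *\<^sub>R frechet_derivative f (at x) 1" for h
      using scaleR[of h 1] by simp
    then have "frechet_derivative f (at x) = (\<lambda>h. h *\<^sub>R frechet_derivative f (at x) 1)"
      by (rule ext)
    from has_derivative_eq_rhs[OF d this] show ?thesis
      unfolding has_vector_derivative_def .
  qed
qed

lemma smooth_on_antiderivative:
  fixes f :: "real \<Rightarrow> 'a::real_normed_vector"
  assumes "open S" "smooth_on S f'" "\<And>x. x \<in> S \<Longrightarrow> (f has_vector_derivative f' x) (at x)"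
  shows "smooth_on S f"
proof (rule smooth_on_bootstrap[OF assms(1)])
  show "(f has_derivative (\<lambda>h. h *\<^sub>R f' x)) (at x)" if "x \<in> S" for x
    using assms(3)[OF that] by (simp add: has_vector_derivative_def)
  show "Ck_on k S (\<lambda>x. v *\<^sub>R f' x)" for k v
    using smooth_on_scaleR[OF assms(1) smooth_on_const assms(2), of v] unfolding smooth_on_def by blast
qed

section \<open>Curves of unitary matrices\<close>

definition adj_matrix :: "complex ^ 'n ^ 'm \<Rightarrow> complex ^ 'm ^ 'n" where
  "adj_matrix A = (\<chi> i j. cnj (A $ j $ i))"

definition complex_matrix :: "real ^ 'n ^ 'm \<Rightarrow> complex ^ 'n ^ 'm" where
  "complex_matrix A = (\<chi> i j. complex_of_real (A $ i $ j))"

lemma adj_matrix_nth [simp]: "adj_matrix A $ i $ j = cnj (A $ j $ i)"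
  by (simp add: adj_matrix_def)

lemma complex_matrix_nth [simp]: "complex_matrix A $ i $ j = complex_of_real (A $ i $ j)"
  by (simp add: complex_matrix_def)

lemma real_to_complex_vec_nth [simp]: "real_to_complex_vec x $ i = complex_of_real (x $ i)"
  by (simp add: real_to_complex_vec_def)

lemma unitary_matrix_adj: "unitary_matrix U \<longleftrightarrow> adj_matrix U ** U = mat 1"
  by (simp add: unitary_matrix_def adj_matrix_def)

lemma unitary_matrix_adj': "unitary_matrix U \<Longrightarrow> U ** adj_matrix U = mat 1"
  unfolding unitary_matrix_adj by (subst matrix_left_right_inverse)

lemma adj_matrix_mult: "adj_matrix (A ** B) = adj_matrix B ** adj_matrix A"
  by (simp add: vec_eq_iff matrix_matrix_mult_def mult.commute)

lemma adj_matrix_adj_matrix [simp]: "adj_matrix (adj_matrix A) = A"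
  by (simp add: vec_eq_iff)

lemma complex_matrix_mult_vec:
  "complex_matrix A *v real_to_complex_vec x = real_to_complex_vec (A *v x)"
  by (simp add: vec_eq_iff matrix_vector_mult_def)

lemma complex_matrix_mult: "complex_matrix (A ** B) = complex_matrix A ** complex_matrix B"
  by (simp add: vec_eq_iff matrix_matrix_mult_def)

lemma complex_matrix_mat: "complex_matrix (mat c) = mat (complex_of_real c)"
  by (simp add: vec_eq_iff mat_def)

lemma complex_matrix_transpose: "complex_matrix (transpose A) = transpose (complex_matrix A)"
  by (simp add: vec_eq_iff transpose_def)

lemma mat_mult_nth [simp]:
  fixes A :: "'a::comm_semiring_1 ^ 'n ^ 'm"
  shows "(mat c ** A) $ i $ j = c * A $ i $ j" "(A ** mat c) $ i $ j = A $ i $ j * c"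
  by (simp_all add: matrix_matrix_mult_def mat_def if_distrib[of "\<lambda>x. x * _"]
      if_distrib[of "(*) _"] cong: if_cong)

lemma mat_mult_commute: "mat c ** A = A ** mat (c::'a::comm_semiring_1)"
  by (simp add: vec_eq_iff mult.commute)

lemma matrix_add_rdistrib: "(A + B) ** C = A ** C + B ** (C :: 'a::semiring_1 ^ 'n ^ 'm)"
  by (simp add: vec_eq_iff matrix_matrix_mult_def distrib_right sum.distrib)

lemma mat_mult_vec: "mat c *v x = c *s (x :: 'a::comm_semiring_1 ^ 'n)"
  by (simp add: vec_eq_iff matrix_vector_mult_def mat_def if_distrib[of "\<lambda>x. x * _"] cong: if_cong)

lemma has_vector_derivative_vec_nth:
  "(f has_vector_derivative f') F \<Longrightarrow> ((\<lambda>x. f x $ i) has_vector_derivative f' $ i) F"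
  by (rule bounded_linear.has_vector_derivative[OF bounded_linear_vec_nth])

text \<open>The fundamental theorem is stated on compact intervals. The hull of \<open>s\<close> and
  \<open>s0\<close> is widened at both ends inside \<open>I\<close>, which puts \<open>s\<close> in
  the interior and makes the derivative two-sided; the integral from \<open>s0\<close> does not
  depend on the widening.\<close>

lemma real_antiderivative_on_open_interval:
  fixes f :: "real \<Rightarrow> real"
  assumes "open I" "is_interval I" "s0 \<in> I" "continuous_on I f"
  obtains F where "\<And>s. s \<in> I \<Longrightarrow> (F has_vector_derivative f s) (at s)"
proof
  fix s assume s: "s \<in> I"
  obtain e where e: "e > 0" "cball (min s s0) e \<subseteq> I"
    using assms(1,3) s by (metis min_def open_contains_cball_eq)
  obtain d where d: "d > 0" "cball (max s s0) d \<subseteq> I"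
    using assms(1,3) s by (metis max_def open_contains_cball_eq)
  define a b where "a = min s s0 - e" and "b = max s s0 + d"
  have ab: "a \<in> I" "b \<in> I"
    using e d by (auto simp: a_def b_def dist_real_def subset_iff)
  then have I: "{a..b} \<subseteq> I"
    using assms(2) unfolding is_interval_1 by (meson atLeastAtMost_iff subsetI)
  have "((\<lambda>u. LBINT y=s0..u. f y) has_vector_derivative f s) (at s within {a..b})"
    by (rule interval_integral_FTC2)
       (use e d in \<open>auto simp: a_def b_def intro!: continuous_on_subset[OF assms(4)] I[unfolded a_def b_def]\<close>)
  moreover have "at s within {a..b} = at s"
    by (rule at_within_Icc_at) (use e d in \<open>auto simp: a_def b_def\<close>)
  ultimately show "((\<lambda>u. LBINT y=s0..u. f y) has_vector_derivative f s) (at s)" by simp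
qed

text \<open>Writing \<open>B' = B X\<close> with \<open>X + X\<^sup>T = 2 \<i> \<tau>\<close>, the symmetric matrix \<open>B B\<^sup>T\<close>
  satisfies \<open>(B B\<^sup>T)' = 2 \<i> \<tau> B B\<^sup>T\<close>, so that the unitary matrix
  \<open>D = e\<^sup>-\<^sup>i\<^sup>\<phi> B(s0)\<^sup>* B\<close> satisfies \<open>D D\<^sup>T = 1\<close> and is therefore real.\<close>

lemma unitary_curve_phase:
  fixes B B' :: "real \<Rightarrow> complex ^ 'n ^ 'n" and \<tau> :: "real \<Rightarrow> real"
  assumes I: "open I" "is_interval I" "s0 \<in> I"
    and B: "smooth_on I B" "\<And>s. s \<in> I \<Longrightarrow> (B has_vector_derivative B' s) (at s)"
    and unitary: "\<And>s. s \<in> I \<Longrightarrow> unitary_matrix (B s)"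
    and \<tau>: "smooth_on I \<tau>"
    and X: "\<And>s. s \<in> I \<Longrightarrow> adj_matrix (B s) ** B' s + transpose (adj_matrix (B s) ** B' s)
                = mat (2 * \<i> * complex_of_real (\<tau> s))"
  obtains \<phi> D where "smooth_on I \<phi>" "smooth_on I D"
    "\<And>s. s \<in> I \<Longrightarrow> D s ** transpose (D s) = (mat 1 :: real ^ 'n ^ 'n)"
    "\<And>s. s \<in> I \<Longrightarrow> B s = mat (exp (\<i> * complex_of_real (\<phi> s))) ** B s0 ** complex_matrix (D s)"
proof -
  obtain \<phi>0 where \<phi>0: "\<And>s. s \<in> I \<Longrightarrow> (\<phi>0 has_vector_derivative \<tau> s) (at s)"
    using real_antiderivative_on_open_interval[OF I] \<tau>[unfolded smooth_on_def, rule_format, of 0] by auto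
  \<comment> \<open>Vanishing at \<open>s0\<close> gives \<open>e s0 = 1\<close>, so that
    \<open>K s0\<close> below is exactly \<open>U ** transpose U\<close>.\<close>
  define \<phi> where "\<phi> s = \<phi>0 s - \<phi>0 s0" for s
  have d\<phi>: "(\<phi> has_vector_derivative \<tau> s) (at s)" if "s \<in> I" for s
    using \<phi>0[OF that] unfolding \<phi>_def by (auto intro!: derivative_eq_intros)
  have \<phi>: "smooth_on I \<phi>"
    by (rule smooth_on_antiderivative[OF I(1) \<tau> d\<phi>])
  define e where "e s = exp (- (\<i> * complex_of_real (\<phi> s)))" for s
  have e: "smooth_on I e"
    unfolding e_def
    by (intro smooth_on_exp I(1) smooth_on_linear_compose[OF _ _ \<phi>, of "\<lambda>x. - (\<i> * complex_of_real x)"])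
       (auto intro!: bounded_linear_minus bounded_linear_const_mult bounded_linear_of_real)
  have de: "(e has_vector_derivative (- \<i> * \<tau> s) * e s) (at s)" if "s \<in> I" for s
  proof -
    have "((\<lambda>s. - (\<i> * complex_of_real (\<phi> s))) has_vector_derivative - \<i> * \<tau> s) (at s)"
      using d\<phi>[OF that] by (intro derivative_eq_intros) (auto simp: has_real_derivative_iff_has_vector_derivative)
    from field_vector_diff_chain_at[OF this DERIV_exp]
    show ?thesis by (simp add: o_def e_def[abs_def])
  qed
  have e0: "e s0 = 1" and e_nz: "e s \<noteq> 0" and e_cnj: "e s * cnj (e s) = 1" for s
    by (simp_all add: e_def \<phi>_def exp_cnj flip: exp_add)
  define U where "U = B s0"
  have U: "adj_matrix U ** U = mat 1" "U ** adj_matrix U = mat 1"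
    using unitary[OF I(3)] unitary_matrix_adj' unitary_matrix_adj by (auto simp: U_def)
  \<comment> \<open>The square of \<open>e\<close> is the integrating factor: its logarithmic
    derivative \<open>- 2 * \<i> * \<tau>\<close> cancels that of \<open>B ** transpose B\<close>,
    so \<open>K\<close> is constant on the interval.\<close>
  define K where "K s = mat (e s * e s) ** (B s ** transpose (B s))" for s
  have "((\<lambda>s. K s $ k $ l) has_vector_derivative 0) (at s)" if s: "s \<in> I" for s k l
  proof -
    let ?X = "adj_matrix (B s) ** B' s"
    have BX: "B s ** ?X = B' s"
      using unitary_matrix_adj'[OF unitary[OF s]] by (simp add: matrix_mul_assoc)
    have "B' s ** transpose (B s) + B s ** transpose (B' s) =
        B s ** ?X ** transpose (B s) + B s ** transpose (B s ** ?X)"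
      by (simp only: BX)
    also have "\<dots> = B s ** (?X + transpose ?X) ** transpose (B s)"
      by (simp only: matrix_transpose_mul matrix_mul_assoc matrix_add_ldistrib matrix_add_rdistrib)
    also have "\<dots> = mat (2 * \<i> * \<tau> s) ** (B s ** transpose (B s))"
      by (simp only: X[OF s] mat_mult_commute[symmetric] matrix_mul_assoc)
    finally have eq: "(B' s ** transpose (B s)) $ k $ l + (B s ** transpose (B' s)) $ k $ l
        = 2 * \<i> * \<tau> s * (B s ** transpose (B s)) $ k $ l"
      by (simp add: vec_eq_iff del: transpose_def)
    have "((\<lambda>s. (B s ** transpose (B s)) $ k $ l) has_vector_derivative
        (B' s ** transpose (B s)) $ k $ l + (B s ** transpose (B' s)) $ k $ l) (at s)"
      unfolding matrix_matrix_mult_def transpose_def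
      by (auto intro!: derivative_eq_intros has_vector_derivative_vec_nth B(2)[OF s]
          simp: sum.distrib[symmetric] add.commute)
    note d = this[unfolded eq]
    show ?thesis
      unfolding K_def mat_mult_nth
      by (rule has_vector_derivative_eq_rhs[OF has_vector_derivative_mult[OF
            has_vector_derivative_mult[OF de[OF s] de[OF s]] d]])
         (simp add: algebra_simps)
  qed
  then have "K s $ k $ l = K s0 $ k $ l" if "s \<in> I" for s k l
    using has_vector_derivative_zero_constant[of I "\<lambda>s. K s $ k $ l"] I that
    by (metis has_vector_derivative_at_within is_interval_convex)
  then have K: "K s = U ** transpose U" if "s \<in> I" for s
    using that by (simp add: vec_eq_iff K_def U_def e0)
  \<comment> \<open>This is the future \<open>D\<close>, still as a complex matrix.\<close>
  define C where "C s = mat (e s) ** (adj_matrix U ** B s)" for s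
  have CT: "C s ** transpose (C s) = mat 1" if "s \<in> I" for s
  proof -
    have "C s ** transpose (C s) = mat (e s * e s) **
        (adj_matrix U ** (B s ** transpose (B s)) ** transpose (adj_matrix U))"
    proof -
      let ?P = "adj_matrix U ** B s"
      have t: "transpose (C s) = mat (e s) ** transpose ?P"
        by (simp add: C_def vec_eq_iff transpose_def)
      have m: "(mat (e s) ** P) ** (mat (e s) ** Q) = mat (e s * e s) ** (P ** Q)"
        for P Q :: "complex ^ 'n ^ 'n"
        by (simp add: vec_eq_iff matrix_matrix_mult_def[of "mat _ ** _" "mat _ ** _"]
            matrix_matrix_mult_def[of P Q] sum_distrib_left mult_ac)
      have "C s ** transpose (C s) = (mat (e s) ** ?P) ** (mat (e s) ** transpose ?P)"
        by (simp only: t) (simp only: C_def)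
      also have "\<dots> = mat (e s * e s) ** (?P ** transpose ?P)"
        by (rule m)
      finally show ?thesis
        by (simp only: matrix_transpose_mul matrix_mul_assoc)
    qed
    also have "\<dots> = adj_matrix U ** K s ** transpose (adj_matrix U)"
      by (simp add: K_def mat_mult_commute matrix_mul_assoc)
         (metis mat_mult_commute matrix_mul_assoc)
    also have "\<dots> = (adj_matrix U ** U) ** transpose (adj_matrix U ** U)"
      by (simp add: K[OF that] matrix_transpose_mul matrix_mul_assoc)
    finally show ?thesis by (simp add: U transpose_mat)
  qed
  have CU: "C s ** adj_matrix (C s) = mat 1" if "s \<in> I" for s
  proof -
    have t: "adj_matrix (C s) = mat (cnj (e s)) ** adj_matrix (adj_matrix U ** B s)"
      by (simp add: C_def vec_eq_iff)
    have m: "mat (e s) ** P ** (mat (cnj (e s)) ** Q) = P ** Q"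
      for P Q :: "complex ^ 'n ^ 'n"
    proof -
      have "(e s * x) * (cnj (e s) * y) = (e s * cnj (e s)) * (x * y)" for x y
        by (simp only: mult_ac)
      then show ?thesis
        by (simp only: vec_eq_iff matrix_matrix_mult_def[of "mat _ ** _" "mat _ ** _"] vec_lambda_beta
            matrix_matrix_mult_def[of P Q] mat_mult_nth e_cnj mult_1_left) simp
    qed
    have "C s ** adj_matrix (C s) = (mat (e s) ** (adj_matrix U ** B s)) **
        (mat (cnj (e s)) ** adj_matrix (adj_matrix U ** B s))"
      by (simp only: t) (simp only: C_def)
    also have "\<dots> = (adj_matrix U ** B s) ** adj_matrix (adj_matrix U ** B s)"
      by (rule m)
    also have "\<dots> = adj_matrix U ** (B s ** adj_matrix (B s)) ** U"
      by (simp only: adj_matrix_mult adj_matrix_adj_matrix matrix_mul_assoc)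
    finally have "C s ** adj_matrix (C s) = adj_matrix U ** (B s ** adj_matrix (B s)) ** U" .
    then show ?thesis
      using unitary_matrix_adj'[OF unitary[OF that]] U by simp
  qed
  \<comment> \<open>Transpose and adjoint of \<open>C s\<close> are both inverse to
    \<open>C s\<close>, hence equal, which says that its entries are real.\<close>
  have real: "cnj (C s $ i $ j) = C s $ i $ j" if "s \<in> I" for s i j
  proof -
    have "adj_matrix (C s) ** C s = mat 1"
      using CU[OF that] by (simp add: matrix_left_right_inverse)
    then have "transpose (C s) = adj_matrix (C s)"
      by (metis CT[OF that] matrix_mul_assoc matrix_mul_lid matrix_mul_rid)
    then show ?thesis by (simp add: vec_eq_iff transpose_def)
  qed
  define D where "D s = (\<chi> i j. Re (C s $ i $ j))" for s
  have CD: "C s = complex_matrix (D s)" if "s \<in> I" for s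
    using real[OF that] by (simp add: vec_eq_iff D_def complex_eq_iff)
  show ?thesis
  proof
    show "smooth_on I \<phi>" by (rule \<phi>)
    have "smooth_on I (\<lambda>s. B s $ k $ j)" for k j
      by (intro smooth_on_vec_nth I(1) B(1))
    then have "smooth_on I (\<lambda>s. C s $ i $ j)" for i j
      unfolding C_def mat_mult_nth matrix_matrix_mult_def[of "adj_matrix U"]
      by (auto intro!: smooth_on_mult smooth_on_sum I(1) e)
    then have "smooth_on I (\<lambda>s. D s $ i $ j)" for i j
      using smooth_on_linear_compose[OF bounded_linear_Re I(1)] by (simp add: D_def)
    then show "smooth_on I D"
      by (intro smooth_on_vec I(1))
    show "D s ** transpose (D s) = mat 1" if "s \<in> I" for s
    proof -
      have "complex_matrix (D s ** transpose (D s)) = complex_matrix (mat 1)"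
        using CT[OF that] by (simp add: CD[OF that] complex_matrix_mult complex_matrix_transpose complex_matrix_mat)
      then show ?thesis by (simp add: vec_eq_iff)
    qed
    show "B s = mat (exp (\<i> * complex_of_real (\<phi> s))) ** B s0 ** complex_matrix (D s)"
      if "s \<in> I" for s
    proof -
      have "mat (exp (\<i> * complex_of_real (\<phi> s))) ** U ** C s =
          mat (exp (\<i> * complex_of_real (\<phi> s))) ** mat (e s) ** (U ** adj_matrix U) ** B s"
        by (simp only: C_def matrix_mul_assoc)
           (simp only: matrix_mul_assoc[symmetric] mat_mult_commute[of "e s"])
      also have "mat (exp (\<i> * complex_of_real (\<phi> s))) ** mat (e s) = (mat 1 :: complex ^ 'n ^ 'n)"
      proof -
        have "exp (\<i> * complex_of_real (\<phi> s)) * e s = 1"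
          by (simp add: e_def flip: exp_add)
        then show ?thesis
          by (simp only: vec_eq_iff mat_mult_nth) (simp add: mat_def)
      qed
      finally show ?thesis by (simp add: U U_def[symmetric] CD[OF that])
    qed
  qed
qed

section \<open>Lagrangian families of spheres\<close>

lemma real_to_complex_vec_add: "real_to_complex_vec (x + y) = real_to_complex_vec x + real_to_complex_vec y"
  by (simp add: vec_eq_iff)

lemma real_to_complex_vec_minus: "real_to_complex_vec (- x) = - real_to_complex_vec x"
  by (simp add: vec_eq_iff)

lemma real_to_complex_vec_diff: "real_to_complex_vec (x - y) = real_to_complex_vec x - real_to_complex_vec y"
  by (simp add: vec_eq_iff)

lemma real_to_complex_vec_scaleR: "real_to_complex_vec (c *\<^sub>R x) = c *\<^sub>R real_to_complex_vec x"
  by (simp add: vec_eq_iff complex_eq_iff)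

lemma matrix_vector_mult_scaleR_complex:
  fixes A :: "complex ^ 'n ^ 'm"
  shows "A *v (c *\<^sub>R x) = c *\<^sub>R (A *v x)"
  using bounded_linear.linear[OF matrix_vector_mul_bounded_linear[of A]] by (rule linear_scale)

lemma matrix_vector_mult_minus_complex:
  fixes A :: "complex ^ 'n ^ 'm"
  shows "A *v (- x) = - (A *v x)"
  using bounded_linear.linear[OF matrix_vector_mul_bounded_linear[of A]] by (rule linear_neg)

lemma matrix_real_to_complex_axis: "A *v real_to_complex_vec (axis j 1) = column j A"
  by (simp add: vec_eq_iff matrix_vector_mult_def axis_def column_def if_distrib cong: if_cong)

lemma bounded_linear_matrix_left: "bounded_linear (\<lambda>A :: complex ^ 'n ^ 'm. A *v x)"
  unfolding linear_conv_bounded_linear[symmetric] linear_iff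
  by (simp add: vec_eq_iff matrix_vector_mult_def sum.distrib distrib_right scaleR_sum_right)

text \<open>A real-linear map on real n-space extends complex-linearly. This replaces the rotation
  of real 2n-space by a complex matrix that carries just its restriction to real n-space.\<close>

lemma linear_real_as_complex_matrix:
  fixes f :: "real ^ 'n \<Rightarrow> complex ^ 'm"
  assumes "linear f"
  shows "f x = (\<chi> k j. f (axis j 1) $ k) *v real_to_complex_vec x"
proof -
  have "f x = f (\<Sum>j\<in>UNIV. x $ j *s axis j 1)"
    by (simp only: basis_expansion)
  also have "\<dots> = (\<Sum>j\<in>UNIV. x $ j *\<^sub>R f (axis j 1))"
    by (simp add: linear_sum[OF assms] scalar_mult_eq_scaleR linear_scale[OF assms])
  finally show ?thesis
    by (simp add: vec_eq_iff matrix_vector_mult_def) (simp add: scaleR_conv_of_real mult.commute)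
qed

lemma inner_real_coords: "real_coords z \<bullet> real_coords w = z \<bullet> w"
  unfolding inner_vec_def UNIV_Plus_UNIV[symmetric]
  by (simp add: sum.Plus real_coords_def inner_complex_def sum.distrib del: UNIV_Plus_UNIV)

lemma inner_of_real_coords: "of_real_coords u \<bullet> of_real_coords v = u \<bullet> v"
  by (metis inner_real_coords real_coords_of_real_coords)

lemma inner_real_to_complex_vec: "real_to_complex_vec x \<bullet> real_to_complex_vec y = x \<bullet> y"
  by (simp add: inner_vec_def inner_complex_def)

lemma orthogonal_matrix_inner:
  fixes M :: "real ^ 'n ^ 'n"
  assumes "orthogonal_matrix M"
  shows "(M *v u) \<bullet> (M *v v) = u \<bullet> v"
proof -
  have "(M *v u) \<bullet> (M *v v) = u \<bullet> ((transpose M ** M) *v v)"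
    using dot_lmul_matrix[of u "transpose M" "M *v v"]
    by (simp add: matrix_vector_mul_assoc[symmetric] vector_transpose_matrix)
  then show ?thesis
    using assms by (simp add: orthogonal_matrix_def)
qed

text \<open>Rotations preserve the real inner product, which is the real part of the Hermitian one.
  Thus half of the unitarity of \<open>A / r\<close> is available before the Lagrangian condition,
  which supplies the imaginary part.\<close>

lemma sphere_family_affine:
  fixes M :: "real \<Rightarrow> real ^ ('n::finite + 'n) ^ ('n + 'n)"
  assumes "\<And>s. s \<in> I \<Longrightarrow> rotation_matrix (M s)"
  obtains A where
    "sphere_family r M V = (\<lambda>(s, x). A s *v real_to_complex_vec x + V s)"
    "\<And>s i j. s \<in> I \<Longrightarrow> column i (A s) \<bullet> column j (A s) = (if i = j then (r s)\<^sup>2 else 0)"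
proof
  define f where "f s x = r s *\<^sub>R of_real_coords (M s *v real_coords (real_to_complex_vec x))" for s x
  define A where "A s = (\<chi> k j. f s (axis j 1) $ k)" for s
  have "linear (of_real_coords :: real ^ ('n + 'n) \<Rightarrow> complex ^ 'n)"
    by (simp add: linear_iff of_real_coords_def vec_eq_iff complex_eq_iff)
  moreover have "linear (real_coords :: complex ^ 'n \<Rightarrow> real ^ ('n + 'n))"
    by (auto simp add: linear_iff real_coords_def vec_eq_iff split: sum.split)
  ultimately have "linear (f s)" for s
    by (simp add: linear_iff f_def real_to_complex_vec_add real_to_complex_vec_scaleR
        matrix_vector_right_distrib matrix_vector_mult_scaleR scaleR_add_right)
  then have f: "f s x = A s *v real_to_complex_vec x" for s x
    unfolding A_def by (rule linear_real_as_complex_matrix)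
  show "sphere_family r M V = (\<lambda>(s, x). A s *v real_to_complex_vec x + V s)"
    by (simp add: sphere_family_def f[symmetric] fun_eq_iff) (simp add: f_def)
  show "column i (A s) \<bullet> column j (A s) = (if i = j then (r s)\<^sup>2 else 0)" if "s \<in> I" for s i j
  proof -
    have "column i (A s) = f s (axis i 1)" for i
      by (simp add: f matrix_real_to_complex_axis)
    moreover have "(M s *v u) \<bullet> (M s *v v) = u \<bullet> v" for u v
      using assms[OF that] unfolding rotation_matrix_def by (simp add: orthogonal_matrix_inner)
    ultimately show ?thesis
      by (simp add: f_def inner_of_real_coords inner_real_coords inner_real_to_complex_vec
          inner_axis_axis power2_eq_square)
  qed
qed

section \<open>Smoothness of the coefficients of a chart and tangent vectors of its image\<close>

lemma immersion_on_cylinder_smooth: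
  assumes "immersion_on (I \<times> N) f" "open I" "x \<in> N"
  shows "smooth_on I (\<lambda>s. f (s :: real, x))"
proof (rule smooth_on_local)
  fix s assume s: "s \<in> I"
  then obtain A F where AF: "open A" "(s, x) \<in> A" "smooth_on A F" "\<forall>q\<in>(I \<times> N) \<inter> A. F q = f q"
    using assms(1,3) unfolding immersion_on_def by blast
  define T where "T = I \<inter> (\<lambda>\<sigma>. (\<sigma>, x)) -` A"
  have T: "open T"
    unfolding T_def by (intro open_Int assms(2) open_vimage AF(1) continuous_intros)
  have "bounded_linear (\<lambda>\<sigma>::real. (\<sigma>, 0 :: 'a))"
    by (intro bounded_linear_intros)
  from smooth_on_affine_compose[OF this T, of "(0, x)" A F]
  have "smooth_on T (\<lambda>\<sigma>. F (\<sigma>, x))"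
    using AF(3) by (simp add: T_def)
  then have "smooth_on T (\<lambda>\<sigma>. f (\<sigma>, x))"
    by (rule smooth_on_cong[OF T, rotated]) (use AF(4) assms(3) in \<open>auto simp: T_def\<close>)
  then show "\<exists>T. open T \<and> s \<in> T \<and> smooth_on T (\<lambda>s. f (s, x))"
    using T s AF(2) by (auto simp: T_def)
qed

text \<open>The curves through \<open>x\<close> and \<open>- x\<close> are
  \<open>A s x + V s\<close> and \<open>- A s x + V s\<close>; taking \<open>x\<close> along each
  axis, their half sum is \<open>V\<close> and their half difference is a column of
  \<open>A\<close>.\<close>

lemma affine_sphere_immersion_smooth:
  fixes A :: "real \<Rightarrow> complex ^ 'n ^ 'n"
  assumes "immersion_on (I \<times> sphere 0 1) (\<lambda>(s, x). A s *v real_to_complex_vec x + V s)" "open I"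
  shows "smooth_on I A" "smooth_on I V"
proof -
  define g where "g j s = A s *v real_to_complex_vec (axis j 1) + V s" for j s
  define h where "h j s = A s *v real_to_complex_vec (- axis j 1) + V s" for j s
  have g: "smooth_on I (g j)" and h: "smooth_on I (h j)" for j
    using immersion_on_cylinder_smooth[OF assms, of "axis j 1"]
      immersion_on_cylinder_smooth[OF assms, of "- axis j 1"]
    by (simp_all add: g_def[abs_def] h_def[abs_def])
  have gh: "g j s = column j (A s) + V s" "h j s = - column j (A s) + V s" for j s
    by (simp_all add: g_def h_def real_to_complex_vec_minus matrix_vector_mult_minus_complex
        matrix_real_to_complex_axis)
  have "smooth_on I (\<lambda>s. (1/2) *\<^sub>R (g j s + h j s))" for j
    by (intro smooth_on_scaleR smooth_on_add smooth_on_const g h assms(2))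
  then show "smooth_on I V"
    by (simp add: gh scaleR_2[symmetric])
  have "smooth_on I (\<lambda>s. ((1/2) *\<^sub>R (g j s - h j s)) $ k)" for j k
    by (intro smooth_on_vec_nth smooth_on_scaleR smooth_on_diff smooth_on_const g h assms(2))
  moreover have "((1/2) *\<^sub>R (g j s - h j s)) $ k = A s $ k $ j" for j k s
    by (simp add: gh column_def scaleR_2[symmetric])
  ultimately show "smooth_on I A"
    by (intro smooth_on_vec assms(2)) simp
qed

text \<open>The transversal direction is the velocity of the curve with \<open>x\<close> fixed,
  shifted in the parameter because \<open>tangent_space\<close> uses curves based at 0.\<close>

lemma affine_sphere_tangent_line:
  fixes A :: "real \<Rightarrow> complex ^ 'n ^ 'n"
  assumes "open I" "smooth_on I A" "smooth_on I V"
    and A': "(A has_vector_derivative A') (at s)" and V': "(V has_vector_derivative V') (at s)"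
    and "(\<lambda>(s, x). A s *v real_to_complex_vec x + V s) ` (I \<times> S) \<subseteq> L" "s \<in> I" "x \<in> S"
  shows "A' *v real_to_complex_vec x + V' \<in> tangent_space L (A s *v real_to_complex_vec x + V s)"
proof -
  let ?g = "\<lambda>s. A s *v real_to_complex_vec x + V s"
  have g: "smooth_on I ?g"
    by (intro smooth_on_add smooth_on_linear_compose[OF bounded_linear_matrix_left] assms(1-3))
  have g': "(?g has_vector_derivative A' *v real_to_complex_vec x + V') (at s)"
    by (intro has_vector_derivative_add bounded_linear.has_vector_derivative[OF bounded_linear_matrix_left] A' V')
  obtain e where e: "e > 0" "ball s e \<subseteq> I"
    using assms(1,7) by (auto simp: open_contains_ball)
  have I: "\<sigma> + s \<in> I" if "\<sigma> \<in> {-e<..<e}" for \<sigma>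
    using e(2) that by (auto simp: subset_iff dist_real_def)
  have "smooth_on {-e<..<e} (\<lambda>\<sigma>. ?g (\<sigma> + s))"
    by (rule smooth_on_affine_compose[OF bounded_linear_ident _ I g]) auto
  moreover have "((\<lambda>\<sigma>. ?g (\<sigma> + s)) has_vector_derivative A' *v real_to_complex_vec x + V') (at 0)"
  proof -
    have "((\<lambda>\<sigma>. \<sigma> + s) has_vector_derivative 1) (at 0)"
      by (auto intro!: derivative_eq_intros)
    from vector_diff_chain_at[OF this, of ?g] g' show ?thesis by (simp add: o_def)
  qed
  moreover have "(\<lambda>\<sigma>. ?g (\<sigma> + s)) ` {-e<..<e} \<subseteq> L"
    using subsetD[OF assms(6) imageI[of "(_, x)"]] assms(8) I by auto
  ultimately show ?thesis
    unfolding tangent_space_def using e(1)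
    by (auto intro!: exI[of _ e] exI[of _ "\<lambda>\<sigma>. ?g (\<sigma> + s)"])
qed

text \<open>The witness is the image of the great circle
  \<open>cos \<sigma> x + sin \<sigma> v\<close>, which passes through \<open>x\<close> with
  velocity \<open>v\<close>.\<close>

lemma affine_sphere_tangent_circle:
  fixes A :: "real \<Rightarrow> complex ^ 'n ^ 'n"
  assumes "(\<lambda>(s, x). A s *v real_to_complex_vec x + V s) ` (I \<times> sphere 0 1) \<subseteq> L" "s \<in> I"
    and "x \<in> sphere 0 1" "v \<in> sphere 0 1" "x \<bullet> v = 0"
  shows "A s *v real_to_complex_vec v \<in> tangent_space L (A s *v real_to_complex_vec x + V s)"
proof -
  define c where "c \<sigma> = cos \<sigma> *\<^sub>R (A s *v real_to_complex_vec x)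
      + sin \<sigma> *\<^sub>R (A s *v real_to_complex_vec v) + V s" for \<sigma>
  have c: "c \<sigma> = A s *v real_to_complex_vec (cos \<sigma> *\<^sub>R x + sin \<sigma> *\<^sub>R v) + V s" for \<sigma>
    by (simp add: c_def real_to_complex_vec_add real_to_complex_vec_scaleR
        matrix_vector_right_distrib matrix_vector_mult_scaleR_complex)
  \<comment> \<open>Cosine and sine inherit smoothness as real and imaginary part of this
    exponential.\<close>
  have "smooth_on {-1<..<1} (\<lambda>\<sigma>. exp (\<i> * complex_of_real \<sigma>))"
    by (intro smooth_on_exp smooth_on_bounded_linear)
       (auto intro!: bounded_linear_const_mult bounded_linear_of_real)
  from smooth_on_linear_compose[OF bounded_linear_Re _ this]
    smooth_on_linear_compose[OF bounded_linear_Im _ this]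
  have "smooth_on {-1<..<1} (cos :: real \<Rightarrow> real)" "smooth_on {-1<..<1} (sin :: real \<Rightarrow> real)"
    by (simp_all add: Re_exp Im_exp)
  then have "smooth_on {-1<..<1} c"
    unfolding c_def by (intro smooth_on_add smooth_on_scaleR smooth_on_const) auto
  moreover have "(c has_vector_derivative A s *v real_to_complex_vec v) (at 0)"
    unfolding c_def by (auto intro!: derivative_eq_intros)
  moreover have "cos \<sigma> *\<^sub>R x + sin \<sigma> *\<^sub>R v \<in> sphere 0 1" for \<sigma>
  proof -
    have "x \<bullet> x = 1" "v \<bullet> v = 1" "v \<bullet> x = 0"
      using assms(3-5) by (simp_all add: dot_square_norm inner_commute)
    then show ?thesis
      using assms(5) sin_cos_squared_add[of \<sigma>]
      by (simp add: norm_eq_1 inner_add_left inner_add_right power2_eq_square)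
  qed
  then have "c ` {-1<..<1} \<subseteq> L"
    using subsetD[OF assms(1) imageI[of "(s, _)"]] assms(2) by (auto simp: c)
  ultimately show ?thesis
    unfolding tangent_space_def by (auto intro!: exI[of _ 1] exI[of _ c] simp: c_def)
qed

section \<open>The symplectic form as imaginary part of the Hermitian product, and its values on
  chart directions\<close>

lemma symplectic_form_Im: "symplectic_form u v = Im (\<Sum>k\<in>UNIV. cnj (u $ k) * v $ k)"
  by (simp add: symplectic_form_def Im_sum algebra_simps)

lemma symplectic_form_add_left: "symplectic_form (u + v) w = symplectic_form u w + symplectic_form v w"
  by (simp add: symplectic_form_def sum.distrib[symmetric] algebra_simps sum_subtractf)

lemma symplectic_form_add_right: "symplectic_form w (u + v) = symplectic_form w u + symplectic_form w v"
  by (simp add: symplectic_form_def sum.distrib[symmetric] algebra_simps sum_subtractf)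

lemma symplectic_form_scaleR_left: "symplectic_form (c *\<^sub>R u) w = c * symplectic_form u w"
  by (simp add: symplectic_form_def sum_distrib_left algebra_simps)

lemma symplectic_form_scaleR_right: "symplectic_form u (c *\<^sub>R w) = c * symplectic_form u w"
  by (simp add: symplectic_form_def sum_distrib_left algebra_simps)

lemma symplectic_form_minus_left: "symplectic_form (- u) w = - symplectic_form u w"
  using symplectic_form_scaleR_left[of "-1" u w] by simp

lemma symplectic_form_diff_left: "symplectic_form (u - v) w = symplectic_form u w - symplectic_form v w"
  using symplectic_form_add_left[of u "- v" w] symplectic_form_minus_left[of v w] by simp

lemma symplectic_form_diff_right: "symplectic_form w (u - v) = symplectic_form w u - symplectic_form w v"
  using symplectic_form_add_right[of w u "- v"] symplectic_form_scaleR_right[of w "-1" v] by simp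

lemma symplectic_form_commute: "symplectic_form u v = - symplectic_form v u"
  by (simp add: symplectic_form_def sum_negf[symmetric] algebra_simps)

text \<open>Comparing the antipodal points \<open>x\<close> and \<open>- x\<close> separates the
  condition on \<open>A'\<close> from that on \<open>V'\<close>.\<close>

lemma lagrangian_affine_sphere_forms:
  fixes A A' :: "complex ^ 'n ^ 'n"
  assumes card: "CARD('n) \<ge> 3"
    and circle: "\<And>x v w. x \<in> sphere 0 1 \<Longrightarrow> v \<in> sphere 0 1 \<Longrightarrow> w \<in> sphere 0 1 \<Longrightarrow>
      x \<bullet> v = 0 \<Longrightarrow> x \<bullet> w = 0 \<Longrightarrow>
      symplectic_form (A *v real_to_complex_vec v) (A *v real_to_complex_vec w) = 0"
    and line: "\<And>x v. x \<in> sphere 0 1 \<Longrightarrow> v \<in> sphere 0 1 \<Longrightarrow> x \<bullet> v = 0 \<Longrightarrow>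
      symplectic_form (A' *v real_to_complex_vec x + V') (A *v real_to_complex_vec v) = 0"
  shows "symplectic_form (column i A) (column j A) = 0"
    and "i \<noteq> j \<Longrightarrow> symplectic_form (column j A') (column i A) = 0"
    and "symplectic_form (column i A') (column i A) = symplectic_form (column j A') (column j A)"
    and "symplectic_form V' (column i A) = 0"
proof -
  have line2: "symplectic_form (A' *v real_to_complex_vec x) (A *v real_to_complex_vec v) = 0 \<and>
      symplectic_form V' (A *v real_to_complex_vec v) = 0"
    if "x \<in> sphere 0 1" "v \<in> sphere 0 1" "x \<bullet> v = 0" for x v
    using line[of x v] line[of "- x" v] that
    by (simp add: real_to_complex_vec_minus matrix_vector_mult_minus_complex
        symplectic_form_add_left symplectic_form_diff_left)
  \<comment> \<open>The dimension bound enters here: columns \<open>i\<close> and \<open>j\<close>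
    are both images of vectors tangent to the unit sphere at a third axis vector.\<close>
  have third: "\<exists>k. k \<noteq> i \<and> k \<noteq> j" for i j :: 'n
  proof (rule ccontr)
    assume "\<not> ?thesis"
    then have "UNIV \<subseteq> {i, j}" by auto
    then have "CARD('n) \<le> card {i, j}" by (intro card_mono) auto
    also have "\<dots> \<le> 2" by (simp add: card_insert_if)
    finally show False using card by simp
  qed
  show w1: "symplectic_form (column i A) (column j A) = 0" for i j
  proof -
    obtain k where "k \<noteq> i" "k \<noteq> j" using third by blast
    then show ?thesis
      using circle[of "axis k 1" "axis i 1" "axis j 1"]
      by (simp add: inner_axis_axis matrix_real_to_complex_axis)
  qed
  show w2: "symplectic_form (column j A') (column i A) = 0" if "i \<noteq> j" for i j
    using line2[of "axis j 1" "axis i 1"] that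
    by (simp add: inner_axis_axis matrix_real_to_complex_axis)
  show "symplectic_form V' (column i A) = 0"
  proof -
    obtain k where "k \<noteq> i" using third by blast
    then show ?thesis
      using line2[of "axis k 1" "axis i 1"]
      by (simp add: inner_axis_axis matrix_real_to_complex_axis)
  qed
  show "symplectic_form (column i A') (column i A) = symplectic_form (column j A') (column j A)"
  proof (cases "i = j")
    case False
    \<comment> \<open>For this orthonormal pair the mixed terms vanish by the off-diagonal
      relations, and what remains is the difference of the two diagonal values.\<close>
    define x v :: "real ^ 'n" where "x = (1 / sqrt 2) *\<^sub>R (axis i 1 + axis j 1)"
      and "v = (1 / sqrt 2) *\<^sub>R (axis i 1 - axis j 1)"
    have "x \<bullet> x = 1" "v \<bullet> v = 1" "x \<bullet> v = 0"
      using False by (simp_all add: x_def v_def inner_add_left inner_add_right inner_diff_left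
          inner_diff_right inner_axis_axis field_simps)
    then have "x \<in> sphere 0 1" "v \<in> sphere 0 1" "x \<bullet> v = 0"
      by (simp_all add: norm_eq_sqrt_inner)
    from line2[OF this]
    have "symplectic_form (column i A' + column j A') (column i A - column j A) = 0"
      by (simp add: x_def v_def real_to_complex_vec_scaleR real_to_complex_vec_add real_to_complex_vec_diff
          matrix_vector_mult_scaleR_complex matrix_vector_right_distrib matrix_vector_mult_diff_distrib
          matrix_real_to_complex_axis symplectic_form_scaleR_left symplectic_form_scaleR_right)
    then show ?thesis
      using w2[of i j] w2[of j i] False
      by (simp add: symplectic_form_add_left symplectic_form_diff_right)
  qed simp
qed

section \<open>Hermitian products of columns and the unitary normal form\<close>

lemma adj_matrix_mult_nth: "(adj_matrix A ** B) $ i $ j = (\<Sum>k\<in>UNIV. cnj (A $ k $ i) * B $ k $ j)"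
  by (simp add: matrix_matrix_mult_def)

text \<open>With \<open>Im_adj_matrix_mult\<close> this turns orthonormal columns spanning a
  Lagrangian plane into a unitary matrix.\<close>

lemma Re_adj_matrix_mult: "Re ((adj_matrix A ** B) $ i $ j) = column i A \<bullet> column j B"
  by (simp add: adj_matrix_mult_nth inner_vec_def inner_complex_def column_def)

lemma Im_adj_matrix_mult: "Im ((adj_matrix A ** B) $ i $ j) = symplectic_form (column i A) (column j B)"
  by (simp add: adj_matrix_mult_nth symplectic_form_Im column_def)

lemma column_add: "column j (A + B) = column j A + column j B"
  by (simp add: column_def vec_eq_iff)

lemma column_scaleR: "column j (c *\<^sub>R A) = c *\<^sub>R column j A"
  by (simp add: column_def vec_eq_iff)

text \<open>Differentiating \<open>adj_matrix B ** B = mat 1\<close> shows that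
  \<open>adj_matrix B ** B'\<close> is skew-Hermitian.\<close>

lemma unitary_curve_skew:
  fixes B :: "real \<Rightarrow> complex ^ 'n ^ 'n"
  assumes "open I" "s \<in> I" "\<And>s. s \<in> I \<Longrightarrow> unitary_matrix (B s)"
    and B': "(B has_vector_derivative B') (at s)"
  shows "(adj_matrix (B s) ** B') $ i $ j + cnj ((adj_matrix (B s) ** B') $ j $ i) = 0"
proof -
  have "((\<lambda>s. (adj_matrix (B s) ** B s) $ i $ j) has_vector_derivative
      (\<Sum>k\<in>UNIV. cnj (B s $ k $ i) * B' $ k $ j + cnj (B' $ k $ i) * B s $ k $ j)) (at s)"
    unfolding adj_matrix_mult_nth
    by (intro has_vector_derivative_sum has_vector_derivative_mult has_vector_derivative_cnj
        has_vector_derivative_vec_nth B')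
  moreover have "((\<lambda>s. (adj_matrix (B s) ** B s) $ i $ j) has_vector_derivative 0) (at s)"
    by (rule has_vector_derivative_transform_within_open[OF has_vector_derivative_const assms(1,2)])
       (use assms(3) in \<open>simp add: unitary_matrix_adj\<close>)
  ultimately have "(\<Sum>k\<in>UNIV. cnj (B s $ k $ i) * B' $ k $ j + cnj (B' $ k $ i) * B s $ k $ j) = 0"
    by (rule vector_derivative_unique_at)
  then show ?thesis
    by (simp add: adj_matrix_mult_nth sum.distrib mult.commute)
qed

text \<open>For \<open>B = A / r\<close> the Lagrangian relations become the hypotheses of
  \<open>unitary_curve_phase\<close>, and the velocity of the centres has real coordinates in the
  unitary frame \<open>B\<close>.\<close>

lemma lagrangian_affine_spheres_normal_form:
  fixes A :: "real \<Rightarrow> complex ^ 'n ^ 'n"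
  assumes card: "CARD('n) \<ge> 3"
    and I: "open I" "is_interval I" "s0 \<in> I"
    and smooth: "smooth_on I A" "smooth_on I V"
    and r: "\<And>s. s \<in> I \<Longrightarrow> r s > 0"
    and cols: "\<And>s i j. s \<in> I \<Longrightarrow> column i (A s) \<bullet> column j (A s) = (if i = j then (r s)\<^sup>2 else 0)"
    and L: "lagrangian_submanifold L"
    and sub: "(\<lambda>(s, x). A s *v real_to_complex_vec x + V s) ` (I \<times> sphere 0 1) \<subseteq> L"
  obtains U \<phi> W D where "unitary_matrix U" "smooth_on I r" "smooth_on I \<phi>" "smooth_on I W" "smooth_on I D"
    "\<And>s. s \<in> I \<Longrightarrow> D s ** transpose (D s) = (mat 1 :: real ^ 'n ^ 'n)"
    "\<And>s. s \<in> I \<Longrightarrow> A s = mat (complex_of_real (r s) * exp (\<i> * complex_of_real (\<phi> s))) ** U ** complex_matrix (D s)"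
    "\<And>s. s \<in> I \<Longrightarrow> (V has_vector_derivative
        exp (\<i> * complex_of_real (\<phi> s)) *s (U *v real_to_complex_vec (W s))) (at s)"
proof -
  obtain A' where A': "smooth_on I A'" "\<And>s. s \<in> I \<Longrightarrow> (A has_vector_derivative A' s) (at s)"
    using smooth_on_vector_derivative[OF smooth(1)] by blast
  obtain V' where V': "smooth_on I V'" "\<And>s. s \<in> I \<Longrightarrow> (V has_vector_derivative V' s) (at s)"
    using smooth_on_vector_derivative[OF smooth(2)] by blast
  have \<omega>: "symplectic_form u v = 0"
    if "p \<in> L" "u \<in> tangent_space L p" "v \<in> tangent_space L p" for p u v
    using L that unfolding lagrangian_submanifold_def by blast
  have inL: "A s *v real_to_complex_vec x + V s \<in> L" if "s \<in> I" "x \<in> sphere 0 1" for s x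
    using subsetD[OF sub imageI[of "(s, x)"]] that by simp
  have circle: "symplectic_form (A s *v real_to_complex_vec v) (A s *v real_to_complex_vec w) = 0"
    if "s \<in> I" "x \<in> sphere 0 1" "v \<in> sphere 0 1" "w \<in> sphere 0 1" "x \<bullet> v = 0" "x \<bullet> w = 0" for s x v w
    using affine_sphere_tangent_circle[OF sub] inL \<omega> that by blast
  have line: "symplectic_form (A' s *v real_to_complex_vec x + V' s) (A s *v real_to_complex_vec v) = 0"
    if "s \<in> I" "x \<in> sphere 0 1" "v \<in> sphere 0 1" "x \<bullet> v = 0" for s x v
    by (rule \<omega>[OF inL[OF that(1,2)] affine_sphere_tangent_line[OF I(1) smooth A'(2) V'(2) sub]
          affine_sphere_tangent_circle[OF sub]]) (use that in auto)
  have forms: "symplectic_form (column i (A s)) (column j (A s)) = 0"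
      "i \<noteq> j \<Longrightarrow> symplectic_form (column j (A' s)) (column i (A s)) = 0"
      "symplectic_form (column i (A' s)) (column i (A s)) = symplectic_form (column j (A' s)) (column j (A s))"
      "symplectic_form (V' s) (column i (A s)) = 0" if "s \<in> I" for s i j
    by (rule lagrangian_affine_sphere_forms[OF card, where A' = "A' s" and V' = "V' s"],
        blast intro: circle[OF that], blast intro: line[OF that], assumption?)+
  fix k0 :: 'n
  \<comment> \<open>Every column of \<open>A s\<close> has squared length
    \<open>(r s)\<^sup>2\<close>, so any fixed index serves to show that \<open>r\<close> is
    smooth.\<close>
  define q where "q s = column k0 (A s) \<bullet> column k0 (A s)" for s
  have q: "smooth_on I q"
    unfolding q_def matrix_real_to_complex_axis[symmetric]
    by (intro smooth_on_inner smooth_on_linear_compose[OF bounded_linear_matrix_left] I(1) smooth(1))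
  have q_eq: "q s = (r s)\<^sup>2" if "s \<in> I" for s
    using cols[OF that] by (simp add: q_def)
  define u where "u s = inverse (sqrt (q s))" for s
  have u: "smooth_on I u"
    unfolding u_def by (intro smooth_on_inverse_sqrt I(1) q) (metis q_eq r zero_less_power)
  have ur: "u s * r s = 1" and u_eq: "u s = inverse (r s)" if "s \<in> I" for s
    using q_eq[OF that] r[OF that] by (simp_all add: u_def real_sqrt_unique)
  have r_smooth: "smooth_on I r"
    by (rule smooth_on_cong[OF I(1) _ smooth_on_mult[OF I(1) q u]])
       (use q_eq ur in \<open>simp add: power2_eq_square mult.commute mult.left_commute\<close>)
  obtain u' where u': "smooth_on I u'" "\<And>s. s \<in> I \<Longrightarrow> (u has_vector_derivative u' s) (at s)"
    using smooth_on_vector_derivative[OF u] by blast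
  define B B' where "B s = u s *\<^sub>R A s" and "B' s = u s *\<^sub>R A' s + u' s *\<^sub>R A s" for s
  have B: "smooth_on I B" and B'_smooth: "smooth_on I B'"
    unfolding B_def B'_def by (intro smooth_on_add smooth_on_scaleR I(1) smooth u A'(1) u')+
  have B': "(B has_vector_derivative B' s) (at s)" if "s \<in> I" for s
    unfolding B_def B'_def using u'(2)[OF that] A'(2)[OF that]
    by (intro has_vector_derivative_scaleR) (simp_all add: has_real_derivative_iff_has_vector_derivative)
  have unitary: "unitary_matrix (B s)" if "s \<in> I" for s
  proof -
    have "(adj_matrix (B s) ** B s) $ i $ j = mat 1 $ i $ j" for i j
    proof (rule complex_eqI)
      show "Re ((adj_matrix (B s) ** B s) $ i $ j) = Re (mat 1 $ i $ j)"
        using ur[OF that] unfolding Re_adj_matrix_mult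
        by (simp add: B_def column_scaleR cols[OF that] mat_def power2_eq_square mult.left_commute)
      show "Im ((adj_matrix (B s) ** B s) $ i $ j) = Im (mat 1 $ i $ j)"
        unfolding Im_adj_matrix_mult using forms(1)[OF that]
        by (simp add: B_def column_scaleR symplectic_form_scaleR_left symplectic_form_scaleR_right mat_def)
    qed
    then show ?thesis by (simp add: unitary_matrix_adj vec_eq_iff)
  qed
  define X where "X s = adj_matrix (B s) ** B' s" for s
  \<comment> \<open>The term with \<open>u'\<close> drops out because columns of \<open>A s\<close>
    are symplectically orthogonal to one another; the sign is the antisymmetry of the form.\<close>
  have ImX: "Im (X s $ i $ j) = - (u s)\<^sup>2 * symplectic_form (column j (A' s)) (column i (A s))"
    if "s \<in> I" for s i j
    unfolding X_def Im_adj_matrix_mult using forms(1)[OF that, of i j]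
    by (simp add: B_def B'_def column_scaleR column_add symplectic_form_scaleR_left
        symplectic_form_scaleR_right symplectic_form_add_right power2_eq_square
        symplectic_form_commute[of "column i (A s)" "column j (A' s)"])
  define \<tau> where "\<tau> s = Im (X s $ k0 $ k0)" for s
  have "smooth_on I (\<lambda>s. X s $ k0 $ k0)"
    unfolding X_def adj_matrix_mult_nth
    by (intro smooth_on_sum smooth_on_mult smooth_on_linear_compose[OF bounded_linear_cnj]
        smooth_on_vec_nth I(1) B B'_smooth)
  then have \<tau>: "smooth_on I \<tau>"
    unfolding \<tau>_def by (rule smooth_on_linear_compose[OF bounded_linear_Im I(1)])
  \<comment> \<open>Skew-Hermitian means skew real part and symmetric imaginary part. The former
    cancels in the sum, and the latter is \<open>\<tau>\<close> times the identity.\<close>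
  have X: "X s + transpose (X s) = mat (2 * \<i> * complex_of_real (\<tau> s))" if s: "s \<in> I" for s
  proof -
    have skew: "X s $ i $ j + cnj (X s $ j $ i) = 0" for i j
      using unitary_curve_skew[OF I(1) s unitary B'[OF s]] by (simp add: X_def)
    have "X s $ i $ j + X s $ j $ i = (if i = j then 2 * \<i> * complex_of_real (\<tau> s) else 0)" for i j
    proof (cases "i = j")
      case True
      have "Im (X s $ i $ i) = \<tau> s"
        unfolding \<tau>_def ImX[OF s] using forms(3)[OF s, of i k0] by simp
      moreover have "Re (X s $ i $ i) = 0"
        using skew[of i i] by (simp add: complex_eq_iff)
      ultimately show ?thesis
        using True by (simp add: complex_eq_iff)
    next
      case False
      then have "Im (X s $ j $ i) = 0"
        unfolding ImX[OF s] using forms(2)[OF s, of j i] by simp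
      then have "cnj (X s $ j $ i) = X s $ j $ i"
        by (simp add: complex_eq_iff)
      then show ?thesis
        using skew[of i j] False by simp
    qed
    then show ?thesis
      by (simp add: vec_eq_iff transpose_def mat_def)
  qed
  from unitary_curve_phase[OF I B B' unitary \<tau> X[unfolded X_def]]
  obtain \<phi> D where \<phi>: "smooth_on I \<phi>" and D: "smooth_on I D"
    "\<And>s. s \<in> I \<Longrightarrow> D s ** transpose (D s) = (mat 1 :: real ^ 'n ^ 'n)"
    and BD: "\<And>s. s \<in> I \<Longrightarrow> B s = mat (exp (\<i> * complex_of_real (\<phi> s))) ** B s0 ** complex_matrix (D s)"
    by blast
  \<comment> \<open>Coordinates of \<open>V' s\<close> in the frame \<open>B s\<close>; their
    imaginary parts are symplectic pairings of \<open>V' s\<close> with the columns, hence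
    zero.\<close>
  define w where "w s = (\<chi> i. Re ((adj_matrix (B s) *v V' s) $ i))" for s
  have w: "adj_matrix (B s) *v V' s = real_to_complex_vec (w s)" if "s \<in> I" for s
  proof -
    have "Im ((adj_matrix (B s) *v V' s) $ i) = symplectic_form (column i (B s)) (V' s)" for i
      by (simp add: matrix_vector_mult_def symplectic_form_Im column_def)
    also have "\<dots> i = 0" for i
      using forms(4)[OF that, of i] symplectic_form_commute[of "column i (A s)" "V' s"]
      by (simp add: B_def column_scaleR symplectic_form_scaleR_left)
    finally show ?thesis
      by (simp add: vec_eq_iff w_def complex_eq_iff)
  qed
  have "smooth_on I (\<lambda>s. (adj_matrix (B s) *v V' s) $ i)" for i
    unfolding matrix_vector_mult_def vec_lambda_beta adj_matrix_nth
    by (intro smooth_on_sum smooth_on_mult smooth_on_linear_compose[OF bounded_linear_cnj]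
        smooth_on_vec_nth I(1) B V'(1))
  then have "smooth_on I (\<lambda>s. w s $ i)" for i
    using smooth_on_linear_compose[OF bounded_linear_Re I(1)] by (simp add: w_def)
  \<comment> \<open>The curve has this form because \<open>V' = B w\<close> equals
    \<open>exp (\<i> * \<phi>)\<close> times \<open>B s0\<close> applied to
    \<open>D w\<close>.\<close>
  then have W: "smooth_on I (\<lambda>s. D s *v w s)"
    unfolding matrix_vector_mult_def
    by (intro smooth_on_vec I(1)) (simp add: smooth_on_sum smooth_on_mult smooth_on_vec_nth I(1) D(1))
  show thesis
  proof (rule that[OF unitary[OF I(3)] r_smooth \<phi> W D])
    show "A s = mat (complex_of_real (r s) * exp (\<i> * complex_of_real (\<phi> s))) ** B s0 ** complex_matrix (D s)"
      if "s \<in> I" for s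
    proof -
      have "A s $ k $ j = complex_of_real (r s) * B s $ k $ j" for k j
        using ur[OF that] by (simp add: B_def complex_eq_iff mult.assoc[symmetric] mult.commute[of "r s"])
      then show ?thesis
        by (simp add: vec_eq_iff BD[OF that] matrix_mul_assoc[symmetric])
    qed
    show "(V has_vector_derivative exp (\<i> * complex_of_real (\<phi> s)) *s
        (B s0 *v real_to_complex_vec (D s *v w s))) (at s)" if "s \<in> I" for s
    proof -
      have "V' s = B s *v (adj_matrix (B s) *v V' s)"
        by (simp add: matrix_vector_mul_assoc unitary_matrix_adj'[OF unitary[OF that]])
      also have "\<dots> = B s *v real_to_complex_vec (w s)"
        by (simp only: w[OF that])
      also have "\<dots> = exp (\<i> * complex_of_real (\<phi> s)) *s (B s0 *v real_to_complex_vec (D s *v w s))"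
        by (subst BD[OF that])
           (simp only: matrix_vector_mul_assoc[symmetric] complex_matrix_mult_vec mat_mult_vec)
      finally show ?thesis using V'(2)[OF that] by simp
    qed
  qed
qed

section \<open>Rotating the sphere factor of a chart, and the explicit form of the new chart\<close>

lemma bounded_bilinear_matrix_vector_mult:
  "bounded_bilinear (\<lambda>(A :: real ^ 'n ^ 'm) x. A *v x)"
  unfolding bilinear_conv_bounded_bilinear[symmetric] bilinear_def linear_iff
  by (simp add: matrix_vector_right_distrib matrix_vector_mult_add_rdistrib matrix_vector_mult_scaleR
      scaleR_matrix_vector_assoc)

lemma has_derivative_compose_vector:
  assumes "(c has_vector_derivative c') (at x)" "(f has_derivative f') (at (c x))"
  shows "((\<lambda>x. f (c x)) has_vector_derivative f' c') (at x)"
  using vector_derivative_diff_chain_within[OF assms(1) has_derivative_at_withinI[OF assms(2)]]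
  by (simp add: o_def)

text \<open>Up to the affine map \<open>T\<close> and \<open>b\<close>, \<open>g\<close> is
  \<open>f\<close> after the twist \<open>(s, x)\<close> to \<open>(s, R s x)\<close>. Hence
  \<open>T\<close> applied to the differential of \<open>g\<close> is the differential of
  \<open>f\<close> on the pushed vector; the latter is injective and so is the push.\<close>

lemma immersion_on_cylinder_twist:
  fixes R :: "real \<Rightarrow> real ^ 'n ^ 'n" and f :: "real \<times> (real ^ 'n) \<Rightarrow> 'b::euclidean_space"
    and g :: "real \<times> (real ^ 'n) \<Rightarrow> 'c::euclidean_space"
  assumes f: "immersion_on (I \<times> N) f" and I: "open I"
    and R: "smooth_on I R" "\<And>s x. s \<in> I \<Longrightarrow> x \<in> N \<Longrightarrow> R s *v x \<in> N"
      "\<And>s. s \<in> I \<Longrightarrow> inj ((*v) (R s))"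
    and g: "smooth_on (I \<times> UNIV) g"
    and T: "bounded_linear T" "\<And>s x. s \<in> I \<Longrightarrow> x \<in> N \<Longrightarrow> T (g (s, x)) + b = f (s, R s *v x)"
  shows "immersion_on (I \<times> N) g"
  unfolding immersion_on_def
proof (intro ballI exI conjI)
  fix p assume p: "p \<in> I \<times> N"
  then obtain s x where sx: "p = (s, x)" "s \<in> I" "x \<in> N" by blast
  show "open (I \<times> (UNIV :: (real ^ 'n) set))" by (intro open_Times I open_UNIV)
  show "p \<in> I \<times> UNIV" using p by auto
  show "smooth_on (I \<times> UNIV) g" by (rule g)
  show "g q = g q" for q ..
  interpret bilin: bounded_bilinear "\<lambda>(A :: real ^ 'n ^ 'n) x. A *v x"
    by (rule bounded_bilinear_matrix_vector_mult)
  obtain R' where R': "(R has_vector_derivative R') (at s)"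
    using smooth_on_vector_derivative[OF R(1)] sx(2) by metis
  let ?y = "R s *v x"
  have "(s, ?y) \<in> I \<times> N" using R(2) sx by auto
  from bspec[OF f[unfolded immersion_on_def] this]
  obtain A F where A: "open A" "(s, ?y) \<in> A" and F: "smooth_on A F" "\<forall>q\<in>(I \<times> N) \<inter> A. F q = f q"
    and inj: "inj_on (frechet_derivative F (at (s, ?y))) (tangent_space (I \<times> N) (s, ?y))"
    by (elim exE conjE) (rule that)
  let ?DF = "frechet_derivative F (at (s, ?y))" and ?Dg = "frechet_derivative g (at p)"
  \<comment> \<open>The differential of the twist at \<open>p\<close>; the term with
    \<open>R'\<close> accounts for the variation of \<open>R\<close> with \<open>s\<close>.\<close>
  let ?push = "\<lambda>t. (fst t, R s *v snd t + (fst t *\<^sub>R R') *v x)"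
  have push: "?push t \<in> tangent_space (I \<times> N) (s, ?y) \<and> ?DF (?push t) = T (?Dg t)"
    if t: "t \<in> tangent_space (I \<times> N) p" for t
  proof -
    obtain e c where e: "0 < e" and c: "smooth_on {-e<..<e} c" "c ` {-e<..<e} \<subseteq> I \<times> N" "c 0 = p"
      "(c has_vector_derivative t) (at 0)"
      using t unfolding tangent_space_def by blast
    let ?J = "{-e<..<e}"
    define d where "d \<sigma> = (fst (c \<sigma>), R (fst (c \<sigma>)) *v snd (c \<sigma>))" for \<sigma>
    have c1: "smooth_on ?J (\<lambda>\<sigma>. fst (c \<sigma>))" and c2: "smooth_on ?J (\<lambda>\<sigma>. snd (c \<sigma>))"
      by (intro smooth_on_linear_compose[OF bounded_linear_fst _ c(1)]
          smooth_on_linear_compose[OF bounded_linear_snd _ c(1)] open_greaterThanLessThan)+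
    have cI: "fst (c \<sigma>) \<in> I" "snd (c \<sigma>) \<in> N" if "\<sigma> \<in> ?J" for \<sigma>
      using c(2) that by (auto simp: image_subset_iff mem_Times_iff)
    have "smooth_on ?J (\<lambda>\<sigma>. R (fst (c \<sigma>)))"
      by (rule smooth_on_compose_real[OF _ R(1) c1]) (use cI in auto)
    then have d: "smooth_on ?J d"
      unfolding d_def by (intro smooth_on_Pair bilin.smooth_on_prod c1 c2) auto
    have d1: "((\<lambda>\<sigma>. fst (c \<sigma>)) has_vector_derivative fst t) (at 0)"
      and d2: "((\<lambda>\<sigma>. snd (c \<sigma>)) has_vector_derivative snd t) (at 0)"
      using c(4) by (auto intro: bounded_linear.has_vector_derivative[OF bounded_linear_fst]
          bounded_linear.has_vector_derivative[OF bounded_linear_snd])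
    have "((\<lambda>\<sigma>. R (fst (c \<sigma>))) has_vector_derivative fst t *\<^sub>R R') (at 0)"
      using vector_diff_chain_at[OF d1, of R R'] R' c(3) sx(1) by (simp add: o_def)
    from bilin.has_vector_derivative[OF this d2]
    have d': "(d has_vector_derivative ?push t) (at 0)"
      unfolding d_def using c(3) sx(1) by (intro has_vector_derivative_Pair d1) simp
    have d0: "d 0 = (s, ?y)"
      using c(3) sx(1) by (simp add: d_def)
    have dN: "d ` ?J \<subseteq> I \<times> N"
      using cI R(2) by (auto simp: d_def)
    have mem: "?push t \<in> tangent_space (I \<times> N) (s, ?y)"
      unfolding tangent_space_def
      by (intro CollectI exI[of _ e] exI[of _ d] conjI e d dN d0 d')
    have Fd: "((\<lambda>\<sigma>. F (d \<sigma>)) has_vector_derivative ?DF (?push t)) (at 0)"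
      using has_derivative_compose_vector[OF d', of F ?DF] smooth_on_has_derivative[OF F(1) A(2)] d0
      by (simp add: o_def)
    have "p \<in> I \<times> UNIV" using p by auto
    then have gc: "((\<lambda>\<sigma>. g (c \<sigma>)) has_vector_derivative ?Dg t) (at 0)"
      using has_derivative_compose_vector[OF c(4), of g ?Dg] smooth_on_has_derivative[OF g] c(3)
      by (simp add: o_def)
    have "continuous_on ?J d"
      using d unfolding smooth_on_def by (metis Ck_on.simps(1))
    \<comment> \<open>The extension \<open>F\<close> is known to agree with \<open>f\<close> only
      inside \<open>A\<close>, so the two curves are compared only while \<open>d\<close> stays
      there.\<close>
    then have op: "open (?J \<inter> d -` A)"
      by (intro continuous_open_preimage A(1)) auto
    have "((\<lambda>\<sigma>. T (g (c \<sigma>)) + b) has_vector_derivative ?DF (?push t)) (at 0)"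
    proof (rule has_vector_derivative_transform_within_open[OF Fd op])
      show "0 \<in> ?J \<inter> d -` A" using e d0 A(2) by simp
      show "F (d \<sigma>) = T (g (c \<sigma>)) + b" if "\<sigma> \<in> ?J \<inter> d -` A" for \<sigma>
      proof -
        have "d \<sigma> \<in> (I \<times> N) \<inter> A"
          using subsetD[OF dN imageI[of \<sigma>]] that by blast
        then have "F (d \<sigma>) = f (d \<sigma>)" by (rule bspec[OF F(2)])
        also have "\<dots> = T (g (fst (c \<sigma>), snd (c \<sigma>))) + b"
          unfolding d_def by (rule T(2)[OF cI(1) cI(2), symmetric]) (use that in auto)
        finally show ?thesis by simp
      qed
    qed
    moreover have "((\<lambda>\<sigma>. T (g (c \<sigma>)) + b) has_vector_derivative T (?Dg t)) (at 0)"
      using bounded_linear.has_vector_derivative[OF T(1) gc]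
      by (auto intro!: derivative_eq_intros)
    ultimately have "?DF (?push t) = T (?Dg t)"
      by (rule vector_derivative_unique_at)
    with mem show ?thesis by blast
  qed
  show "inj_on ?Dg (tangent_space (I \<times> N) p)"
  proof (rule inj_onI)
    fix t1 t2 assume t: "t1 \<in> tangent_space (I \<times> N) p" "t2 \<in> tangent_space (I \<times> N) p" "?Dg t1 = ?Dg t2"
    then have "?push t1 = ?push t2"
      using push[OF t(1)] push[OF t(2)] by (intro inj_onD[OF inj]) auto
    \<comment> \<open>Equal first components make the \<open>R'\<close> terms cancel.\<close>
    then have "fst t1 = fst t2" "R s *v snd t1 = R s *v snd t2" by auto
    then show "t1 = t2"
      using injD[OF R(3)[OF sx(2)]] by (simp add: prod_eq_iff)
  qed
qed

text \<open>Applying the adjoint of \<open>U\<close> to \<open>V\<close> gives an antiderivative of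
  the integrand, so the integral is a difference of its values.\<close>

lemma lagrangian_sphere_param_eq:
  fixes V :: "real \<Rightarrow> complex ^ 'n" and W :: "real \<Rightarrow> real ^ 'n"
  assumes I: "open I" "is_interval I" "s0 \<in> I" "s \<in> I"
    and U: "unitary_matrix U" and smooth: "smooth_on I \<phi>" "smooth_on I W"
    and V: "\<And>s. s \<in> I \<Longrightarrow> (V has_vector_derivative
        exp (\<i> * complex_of_real (\<phi> s)) *s (U *v real_to_complex_vec (W s))) (at s)"
  shows "lagrangian_sphere_param r \<phi> W s0 (s, x) =
      (complex_of_real (r s) * exp (\<i> * complex_of_real (\<phi> s))) *s real_to_complex_vec x
      + adj_matrix U *v (V s - V s0)"
proof -
  let ?h = "\<lambda>t. exp (\<i> * complex_of_real (\<phi> t)) *s real_to_complex_vec (W t)"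
  \<comment> \<open>The hull is taken with \<open>min\<close> and \<open>max\<close> since
    \<open>s < s0\<close> is allowed.\<close>
  have "min s0 s \<in> I" "max s0 s \<in> I"
    using I by (simp_all add: min_def max_def)
  then have J: "{min s0 s..max s0 s} \<subseteq> I"
    using I(2) unfolding is_interval_1 by (meson atLeastAtMost_iff subsetI)
  have "continuous_on I \<phi>" "continuous_on I W"
    using smooth unfolding smooth_on_def by (metis Ck_on.simps(1))+
  then have "continuous_on I (\<lambda>t. ?h t $ i)" for i
    by (auto intro!: continuous_intros)
  then have cont: "continuous_on I ?h"
    by (subst vec_nth_inverse [symmetric]) (rule continuous_on_vec_lambda)
  have "((\<lambda>t. adj_matrix U *v V t) has_vector_derivative ?h t) (at t)" if "t \<in> I" for t
  proof -
    have "adj_matrix U *v (exp (\<i> * complex_of_real (\<phi> t)) *s (U *v real_to_complex_vec (W t))) = ?h t"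
      using U by (simp add: vec.scale matrix_vector_mul_assoc unitary_matrix_adj)
    with bounded_linear.has_vector_derivative[OF matrix_vector_mul_bounded_linear[of "adj_matrix U"] V[OF that]]
    show ?thesis by simp
  qed
  then have "((\<lambda>t. adj_matrix U *v V t) has_vector_derivative ?h t) (at t within {min s0 s..max s0 s})"
    if "min s0 s \<le> t" "t \<le> max s0 s" for t
    using J that by (meson atLeastAtMost_iff has_vector_derivative_at_within subsetD)
  from interval_integral_FTC_finite[OF continuous_on_subset[OF cont J] this]
  have "(LBINT t=ereal s0..ereal s. ?h t) = adj_matrix U *v V s - adj_matrix U *v V s0" .
  then show ?thesis
    by (simp add: lagrangian_sphere_param_def matrix_vector_mult_diff_distrib)
qed

text \<open>The formula makes sense for every \<open>x\<close>, not only unit vectors, so the chart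
  is its own smooth extension to an open set.\<close>

lemma smooth_on_lagrangian_sphere_param:
  fixes g :: "real \<times> (real ^ 'n) \<Rightarrow> complex ^ 'n"
  assumes I: "open I" and smooth: "smooth_on I r" "smooth_on I \<phi>" "smooth_on I b"
    and g: "\<And>s x. s \<in> I \<Longrightarrow> g (s, x) =
      (complex_of_real (r s) * exp (\<i> * complex_of_real (\<phi> s))) *s real_to_complex_vec x + b s"
  shows "smooth_on (I \<times> UNIV) g"
proof -
  have open_I: "open (I \<times> (UNIV :: (real ^ 'n) set))" by (intro open_Times I open_UNIV)
  have \<gamma>: "smooth_on I (\<lambda>s. complex_of_real (r s) * exp (\<i> * complex_of_real (\<phi> s)))"
    by (intro smooth_on_mult smooth_on_exp smooth_on_const I
        smooth_on_linear_compose[OF bounded_linear_of_real] smooth)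
  have fst: "smooth_on (I \<times> (UNIV :: (real ^ 'n) set)) (\<lambda>p. h (fst p))" if "smooth_on I h"
    for h :: "real \<Rightarrow> 'z::real_normed_vector"
    by (rule smooth_on_compose_real[OF open_I that smooth_on_bounded_linear[OF bounded_linear_fst]]) auto
  have "smooth_on (I \<times> UNIV) (\<lambda>p. complex_of_real (snd p $ i))" for i :: 'n
    by (intro smooth_on_linear_compose[OF bounded_linear_of_real] smooth_on_vec_nth open_I
        smooth_on_bounded_linear bounded_linear_snd)
  from smooth_on_mult[OF open_I fst[OF \<gamma>] this] smooth_on_vec_nth[OF open_I fst[OF smooth(3)]]
  have "smooth_on (I \<times> UNIV) (\<lambda>p. (complex_of_real (r (fst p)) * exp (\<i> * complex_of_real (\<phi> (fst p))))
      * complex_of_real (snd p $ i) + b (fst p) $ i)" for i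
    by (intro smooth_on_add open_I)
  then have "smooth_on (I \<times> UNIV) (\<lambda>p. g p $ i)" for i
    by (rule smooth_on_cong[OF open_I, rotated]) (auto simp: g)
  then show ?thesis by (rule smooth_on_vec[OF open_I])
qed

theorem theorem1:
  fixes L :: "(complex ^ 'n) set"
  assumes "CARD('n) \<ge> 3"
    and "lagrangian_submanifold L"
    and "foliated_by_round_spheres L"
  shows "\<forall>p\<in>L. \<exists>I s0 r \<phi> W U c.
           open I \<and> is_interval I \<and> s0 \<in> I \<and>
           smooth_on I r \<and> (\<forall>s\<in>I. r s > 0) \<and> smooth_on I \<phi> \<and> smooth_on I W \<and>
           immersion_on (I \<times> sphere 0 1) (lagrangian_sphere_param r \<phi> W s0) \<and>
           unitary_matrix U \<and>
           p \<in> (\<lambda>z. U *v z + c) ` lagrangian_sphere_param r \<phi> W s0 ` (I \<times> sphere 0 1) \<and>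
           openin (top_of_set L)
             ((\<lambda>z. U *v z + c) ` lagrangian_sphere_param r \<phi> W s0 ` (I \<times> sphere 0 1))"
proof
  fix p assume "p \<in> L"
  obtain \<F> where \<F>: "\<forall>p\<in>L. \<exists>I r M V. open I \<and> is_interval I \<and>
      (\<forall>s\<in>I. r s > 0 \<and> rotation_matrix (M s)) \<and>
      immersion_on (I \<times> sphere 0 1) (sphere_family r M V) \<and>
      (\<forall>s\<in>I. sphere_family r M V ` ({s} \<times> sphere 0 1) \<in> \<F>) \<and>
      p \<in> sphere_family r M V ` (I \<times> sphere 0 1) \<and>
      openin (top_of_set L) (sphere_family r M V ` (I \<times> sphere 0 1))"
    using assms(3) unfolding foliated_by_round_spheres_def by (elim exE conjE)
  from bspec[OF \<F> \<open>p \<in> L\<close>] obtain I r M V where I: "open I" "is_interval I"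
    and rM': "\<forall>s\<in>I. r s > 0 \<and> rotation_matrix (M s)"
    and imm: "immersion_on (I \<times> sphere 0 1) (sphere_family r M V)"
    and p: "p \<in> sphere_family r M V ` (I \<times> sphere 0 1)"
    and op: "openin (top_of_set L) (sphere_family r M V ` (I \<times> sphere 0 1))"
    by (elim exE conjE) (rule that)
  have rM: "\<And>s. s \<in> I \<Longrightarrow> r s > 0" "\<And>s. s \<in> I \<Longrightarrow> rotation_matrix (M s)"
    using rM' by auto
  obtain A where F: "sphere_family r M V = (\<lambda>(s, x). A s *v real_to_complex_vec x + V s)"
    and cols: "\<And>s i j. s \<in> I \<Longrightarrow> column i (A s) \<bullet> column j (A s) = (if i = j then (r s)\<^sup>2 else 0)"
    using sphere_family_affine[of I M r V] rM(2) by blast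
  \<comment> \<open>Any base point in \<open>I\<close> will do; \<open>p\<close> only guarantees
    that there is one.\<close>
  from p obtain s0 where s0: "s0 \<in> I" by auto
  note AV = affine_sphere_immersion_smooth[OF imm[unfolded F] I(1)]
  have sub: "(\<lambda>(s, x). A s *v real_to_complex_vec x + V s) ` (I \<times> sphere 0 1) \<subseteq> L"
    using openin_imp_subset[OF op] by (simp add: F)
  obtain U \<phi> W D where U: "unitary_matrix U"
    and smooth: "smooth_on I r" "smooth_on I \<phi>" "smooth_on I W" "smooth_on I D"
    and D: "\<And>s. s \<in> I \<Longrightarrow> D s ** transpose (D s) = (mat 1 :: real ^ 'n ^ 'n)"
    and A: "\<And>s. s \<in> I \<Longrightarrow> A s = mat (complex_of_real (r s) * exp (\<i> * complex_of_real (\<phi> s))) ** U ** complex_matrix (D s)"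
    and V: "\<And>s. s \<in> I \<Longrightarrow> (V has_vector_derivative
        exp (\<i> * complex_of_real (\<phi> s)) *s (U *v real_to_complex_vec (W s))) (at s)"
    using lagrangian_affine_spheres_normal_form[OF assms(1) I s0 AV rM(1) cols assms(2) sub] by blast
  \<comment> \<open>\<open>R s\<close> is inverse to \<open>D s\<close>, so precomposing with it
    strips the real orthogonal factor from \<open>A s\<close>.\<close>
  define R where "R s = transpose (D s)" for s
  have orth: "orthogonal_matrix (R s)" and DR: "D s ** R s = mat 1" and RD: "R s ** D s = mat 1"
    if "s \<in> I" for s
    using D[OF that] by (simp_all add: R_def orthogonal_matrix_def matrix_left_right_inverse)
  have sphere: "M *v x \<in> sphere 0 1" if "orthogonal_matrix M" "x \<in> sphere 0 1" for M :: "real ^ 'n ^ 'n" and x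
    using that by (simp add: norm_eq_1 orthogonal_matrix_inner)
  let ?l = "lagrangian_sphere_param r \<phi> W s0"
  note l_eq = lagrangian_sphere_param_eq[OF I s0 _ U smooth(2,3) V, where r = r]
  have twist: "U *v ?l (s, x) + V s0 = sphere_family r M V (s, R s *v x)" if "s \<in> I" for s x
  proof -
    have "A s *v real_to_complex_vec (R s *v x) = mat (complex_of_real (r s) * exp (\<i> * complex_of_real (\<phi> s))) *v
        (U *v real_to_complex_vec ((D s ** R s) *v x))"
      by (simp only: A[OF that] matrix_vector_mul_assoc[symmetric] complex_matrix_mult_vec)
    also have "\<dots> = U *v ((complex_of_real (r s) * exp (\<i> * complex_of_real (\<phi> s))) *s real_to_complex_vec x)"
      by (simp add: DR[OF that] mat_mult_vec vec.scale)
    finally have "A s *v real_to_complex_vec (R s *v x) = \<dots>" .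
    then show ?thesis
      using unitary_matrix_adj'[OF U]
      by (simp add: F l_eq[OF that] matrix_vector_right_distrib matrix_vector_mul_assoc)
  qed
  \<comment> \<open>Each \<open>R s\<close> permutes the unit sphere, so both charts have the same
    image; the membership of \<open>p\<close> and relative openness carry over unchanged.\<close>
  have image: "(\<lambda>z. U *v z + V s0) ` ?l ` (I \<times> sphere 0 1) = sphere_family r M V ` (I \<times> sphere 0 1)"
  proof -
    have "(\<lambda>(s, x). (s, R s *v x)) ` (I \<times> sphere 0 1) = I \<times> sphere 0 1"
    proof (intro equalityI subsetI)
      fix q assume "q \<in> (\<lambda>(s, x). (s, R s *v x)) ` (I \<times> sphere 0 1)"
      then show "q \<in> I \<times> sphere 0 1" using sphere orth by auto
    next
      fix q :: "real \<times> (real ^ 'n)" assume "q \<in> I \<times> sphere 0 1"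
      then obtain s x where q: "q = (s, x)" "s \<in> I" "x \<in> sphere 0 1" by blast
      have "orthogonal_matrix (D s)"
        using orth[OF q(2)] by (simp add: R_def)
      then show "q \<in> (\<lambda>(s, x). (s, R s *v x)) ` (I \<times> sphere 0 1)"
        using q sphere RD[OF q(2)]
        by (intro image_eqI[of _ _ "(s, D s *v x)"]) (auto simp: matrix_vector_mul_assoc)
    qed
    then have "sphere_family r M V ` (I \<times> sphere 0 1) =
        sphere_family r M V ` (\<lambda>(s, x). (s, R s *v x)) ` (I \<times> sphere 0 1)"
      by (simp only:)
    also have "\<dots> = (\<lambda>q. U *v ?l q + V s0) ` (I \<times> sphere 0 1)"
      unfolding image_image using twist by (intro image_cong) auto
    finally show ?thesis by (simp only: image_image)
  qed
  have "smooth_on I (\<lambda>s. adj_matrix U *v (V s - V s0))"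
    by (intro smooth_on_linear_compose[OF matrix_vector_mul_bounded_linear] smooth_on_diff
        smooth_on_const AV I(1))
  from smooth_on_lagrangian_sphere_param[OF I(1) smooth(1,2) this l_eq]
  have l_smooth: "smooth_on (I \<times> UNIV) ?l" .
  have "smooth_on I (\<lambda>s. R s $ i $ j)" for i j
    by (simp add: R_def transpose_def) (intro smooth_on_vec_nth I(1) smooth(4))
  then have R_smooth: "smooth_on I R"
    by (intro smooth_on_vec I(1))
  have inj: "inj ((*v) (R s))" if "s \<in> I" for s
    using DR[OF that] by (auto simp: matrix_left_invertible_injective[symmetric])
  have l_imm: "immersion_on (I \<times> sphere 0 1) ?l"
    by (rule immersion_on_cylinder_twist[OF imm I(1) R_smooth sphere[OF orth] inj l_smooth
          matrix_vector_mul_bounded_linear twist])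
  show "\<exists>I s0 r \<phi> W U c.
           open I \<and> is_interval I \<and> s0 \<in> I \<and>
           smooth_on I r \<and> (\<forall>s\<in>I. r s > 0) \<and> smooth_on I \<phi> \<and> smooth_on I W \<and>
           immersion_on (I \<times> sphere 0 1) (lagrangian_sphere_param r \<phi> W s0) \<and>
           unitary_matrix U \<and>
           p \<in> (\<lambda>z. U *v z + c) ` lagrangian_sphere_param r \<phi> W s0 ` (I \<times> sphere 0 1) \<and>
           openin (top_of_set L)
             ((\<lambda>z. U *v z + c) ` lagrangian_sphere_param r \<phi> W s0 ` (I \<times> sphere 0 1))"
    by (rule exI[of _ I], rule exI[of _ s0], rule exI[of _ r], rule exI[of _ \<phi>], rule exI[of _ W],
        rule exI[of _ U], rule exI[of _ "V s0"], unfold image,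
        intro conjI ballI I s0 smooth rM(1) l_imm U p op)
qed

end
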